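(* Let $d\ge 2$, let $a_1,\dots,a_d$ be positive integers, $n=\prod_{i=1}^d a_i$, $b_i=n/a_i$ for $i\in[d]$, and $N=n^{d-1}$. Let $H:[n]^d\to[N]$ be an $(n,d,d-1,1)$ Latin hypercube, and let $C\subseteq\Omega$ be the graph of its symbol assignment, with characteristic vector $\chi$. Then $H$ is a Sudoku hypercube (of block size $(b_1,\dots,b_d)$, with respect to the prescribed block partition) if and only if $C$ is a Delsarte $\mathcal I_1\times\cdots\times\mathcal I_d\times\{1\}$-design in the association scheme $\mathfrak X$.
   Context: Write $[n]=\{1,\dots,n\}$. Hypercubes. A hypercube of order $n$ and dimension $d$ on a symbol set $S$ is a function $H:[n]^d\to S$. A hyperplane is the set of cells obtained by fixing one coordinate. An $(n,d,d-1,1)$ Latin hypercube is a hypercube on a symbol set of size $N=n^{d-1}$ such that every hyperplane contains each symbol exactly once. For each $j\in[d]$ the $j$th coordinate set $[n]$ is partitioned into $a_j$ prescribed groups of size $b_j$; the prescribed Cartesian blocks are the products of $d$ groups, one from each coordinate. A Sudoku hypercube of block size $(b_1,\dots,b_d)$ is an $(n,d,d-1,1)$ Latin hypercube in which every prescribed Cartesian block contains each symbol exactly once. Identification. For $j\in[d]$, the $j$th coordinate set $[n]$ is identified with $[b_j]\times[a_j]$ so that the prescribed groups are $[b_j]\times\{s\}$, $s\in[a_j]$. Let $\Omega=\prod_{j\in[d]}([b_j]\times[a_j])\times[N]$ and $$C=\{(x_1,\dots,x_d,H(x_1,\dots,x_d)) : x_j\in[b_j]\times[a_j]\text{ for }j\in[d]\}\subseteq\Omega,$$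 and let $\chi\in\mathbb R^\Omega$ be the characteristic vector of $C$. Idempotents. For $m\ge 2$ let $E_0^{(m)}=\frac1m J_m$ and $E_1^{(m)}=I_m-\frac1m J_m$, where $I_m$ is the identity and $J_m$ the all-ones $m\times m$ matrix; for $m=1$ let $E_0^{(1)}=I_1$ and $E_1^{(1)}=0$. For $j\in[d]$ let $$F_0^{(j)}=E_0^{(b_j)}\otimes E_0^{(a_j)},\qquad F_1^{(j)}=E_0^{(b_j)}\otimes E_1^{(a_j)},\qquad F_2^{(j)}=E_1^{(b_j)}\otimes I_{a_j}.$$ (If $a_j=1$ or $b_j=1$, one of $F_1^{(j)},F_2^{(j)}$ is zero, and the nonzero ones are relabeled so that $F_0^{(j)}=\frac1nJ$ and $F_1^{(j)}$ is the other nonzero one.) Scheme. $H(1,m)$ denotes the one-class association scheme on $m$ points (trivial for $m=1$), $\otimes$ the direct product and $\wr$ the wreath product of association schemes, with the convention that if $\mathfrak A,\mathfrak B$ have primitive idempotents $E_0,\dots,E_r$ and $F_0,\dots,F_s$, then those of $\mathfrak A\wr\mathfrak B$ are $E_0\otimes F_j$ ($0\le j\le s$) together with $E_i\otimes I$ ($1\le i\le r$). Let $$\mathfrak X=(H(1,b_1)\wr H(1,a_1))\otimes\cdots\otimes(H(1,b_d)\wr H(1,a_d))\otimes H(1,N)$$ on the underlying set $\Omega$. Its primitive idempotents are the nonzero matrices among $F_{i_1}^{(1)}\otimes\cdots\otimes F_{i_d}^{(d)}\otimes E_i^{(N)}$, with $i_j\in\{0,1,2\}$ and $i\in\{0,1\}$;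 this tensor product is indexed by $(i_1,\dots,i_d,i)$. Designs. For a set $T$ of indices of this form, not containing $(0,\dots,0,0)$, $C$ is a Delsarte $T$-design if $\bigl(F_{i_1}^{(1)}\otimes\cdots\otimes F_{i_d}^{(d)}\otimes E_i^{(N)}\bigr)\chi=0$ for every $(i_1,\dots,i_d,i)\in T$ (a zero tensor product imposes no condition). Index sets. For $k\in[d]$ let $\varepsilon_k=1$ if $a_k\ge 2$ and $\varepsilon_k=0$ if $a_k=1$, and let $\mathcal I_k=\{i\in\mathbb Z : 0\le i\le\varepsilon_k\}$. *)

theory Defs
  imports Complex_Main "HOL-Library.FuncSet" "HOL-Library.Disjoint_Sets"
begin

section \<open>Hypercubes\<close>

definition cells :: "nat \<Rightarrow> nat \<Rightarrow> (nat \<Rightarrow> nat) set" where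
  "cells n d = {1..d} \<rightarrow>\<^sub>E {1..n}"

definition hyperplane :: "nat \<Rightarrow> nat \<Rightarrow> nat \<Rightarrow> nat \<Rightarrow> (nat \<Rightarrow> nat) set" where
  "hyperplane n d j c = {x \<in> cells n d. x j = c}"

definition each_symbol_once ::
    "'s set \<Rightarrow> ((nat \<Rightarrow> nat) \<Rightarrow> 's) \<Rightarrow> (nat \<Rightarrow> nat) set \<Rightarrow> bool" where
  "each_symbol_once S H B \<longleftrightarrow> (\<forall>s\<in>S. \<exists>!x. x \<in> B \<and> H x = s)"

definition latin_hypercube ::
    "nat \<Rightarrow> nat \<Rightarrow> 's set \<Rightarrow> ((nat \<Rightarrow> nat) \<Rightarrow> 's) \<Rightarrow> bool" where
  "latin_hypercube n d S H \<longleftrightarrow>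
     finite S \<and> card S = n ^ (d - 1) \<and> H \<in> cells n d \<rightarrow> S \<and>
     (\<forall>j\<in>{1..d}. \<forall>c\<in>{1..n}. each_symbol_once S H (hyperplane n d j c))"

text \<open>\<open>P\<close> is the collection of prescribed groups of one coordinate set \<open>{1..n}\<close>.\<close>

definition group_partition :: "nat \<Rightarrow> nat \<Rightarrow> nat \<Rightarrow> nat set set \<Rightarrow> bool" where
  "group_partition n a b P \<longleftrightarrow>
     partition_on {1..n} P \<and> card P = a \<and> (\<forall>g\<in>P. card g = b)"

definition cartesian_blocks :: "nat \<Rightarrow> (nat \<Rightarrow> nat set set) \<Rightarrow> (nat \<Rightarrow> nat) set set" where
  "cartesian_blocks d P = {Pi\<^sub>E {1..d} g | g. \<forall>j\<in>{1..d}. g j \<in> P j}"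

definition sudoku_hypercube ::
    "nat \<Rightarrow> nat \<Rightarrow> (nat \<Rightarrow> nat set set) \<Rightarrow> 's set \<Rightarrow> ((nat \<Rightarrow> nat) \<Rightarrow> 's) \<Rightarrow> bool" where
  "sudoku_hypercube n d P S H \<longleftrightarrow>
     latin_hypercube n d S H \<and> (\<forall>B\<in>cartesian_blocks d P. each_symbol_once S H B)"

definition identification ::
    "nat \<Rightarrow> nat \<Rightarrow> nat \<Rightarrow> nat set set \<Rightarrow> (nat \<Rightarrow> nat \<times> nat) \<Rightarrow> bool" where
  "identification n a b P \<phi> \<longleftrightarrow>
     bij_betw \<phi> {1..n} ({1..b} \<times> {1..a}) \<and>
     (\<lambda>g. \<phi> ` g) ` P = (\<lambda>s. {1..b} \<times> {s}) ` {1..a}"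

definition hypercube_graph ::
    "nat \<Rightarrow> nat \<Rightarrow> (nat \<Rightarrow> nat \<Rightarrow> nat \<times> nat) \<Rightarrow> ((nat \<Rightarrow> nat) \<Rightarrow> 's)
      \<Rightarrow> ((nat \<Rightarrow> nat \<times> nat) \<times> 's) set" where
  "hypercube_graph n d \<phi> H = (\<lambda>x. (\<lambda>j\<in>{1..d}. \<phi> j (x j), H x)) ` cells n d"


section \<open>Association schemes with labelled idempotents\<close>

text \<open>
  Matrices indexed by the points of a scheme are functions of two arguments, and only
  their entries at points are meaningful.  Relations and primitive idempotents are both
  labelled by \<open>Idx\<close>; the label of a relation bears no relation to that of an idempotent.
  Outside \<open>Idx\<close> the idempotents of the schemes below are zero.
\<close>

type_synonym 'x mat = "'x \<Rightarrow> 'x \<Rightarrow> real"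

record ('x, 'i) scheme =
  Points :: "'x set"
  Idx :: "'i set"
  Rel :: "'i \<Rightarrow> 'x rel"
  Idem :: "'i \<Rightarrow> 'x mat"

definition mat_eq :: "'x set \<Rightarrow> 'x mat \<Rightarrow> 'x mat \<Rightarrow> bool" where
  "mat_eq V M K \<longleftrightarrow> (\<forall>x\<in>V. \<forall>y\<in>V. M x y = K x y)"

definition mat_mult :: "'x set \<Rightarrow> 'x mat \<Rightarrow> 'x mat \<Rightarrow> 'x mat" where
  "mat_mult V M K = (\<lambda>x y. \<Sum>z\<in>V. M x z * K z y)"

definition mat_vec :: "'x set \<Rightarrow> 'x mat \<Rightarrow> ('x \<Rightarrow> real) \<Rightarrow> 'x \<Rightarrow> real" where
  "mat_vec V M v = (\<lambda>x. \<Sum>y\<in>V. M x y * v y)"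

definition id_mat :: "'x mat" where
  "id_mat = (\<lambda>x y. of_bool (x = y))"

definition tensor :: "'x mat \<Rightarrow> 'y mat \<Rightarrow> ('x \<times> 'y) mat" where
  "tensor M K = (\<lambda>(x, y) (x', y'). M x x' * K y y')"

definition association_scheme :: "('x, 'i) scheme \<Rightarrow> bool" where
  "association_scheme X \<longleftrightarrow>
     finite (Points X) \<and> Points X \<noteq> {} \<and> finite (Idx X) \<and>
     (\<forall>i\<in>Idx X. Rel X i \<noteq> {} \<and> Rel X i \<subseteq> Points X \<times> Points X \<and> sym (Rel X i)) \<and>
     (\<forall>x\<in>Points X. \<forall>y\<in>Points X. \<exists>!i. i \<in> Idx X \<and> (x, y) \<in> Rel X i) \<and>
     (\<exists>i\<in>Idx X. Rel X i = Id_on (Points X)) \<and>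
     (\<forall>i\<in>Idx X. \<forall>j\<in>Idx X. \<forall>k\<in>Idx X. \<exists>p. \<forall>(x, y)\<in>Rel X k.
        card {z \<in> Points X. (x, z) \<in> Rel X i \<and> (z, y) \<in> Rel X j} = p)"

definition bose_mesner :: "('x, 'i) scheme \<Rightarrow> 'x mat \<Rightarrow> bool" where
  "bose_mesner X M \<longleftrightarrow> (\<exists>c. \<forall>x\<in>Points X. \<forall>y\<in>Points X.
     M x y = (\<Sum>i\<in>Idx X. c i * of_bool ((x, y) \<in> Rel X i)))"

definition primitive_idempotent :: "('x, 'i) scheme \<Rightarrow> 'x mat \<Rightarrow> bool" where
  "primitive_idempotent X M \<longleftrightarrow>
     bose_mesner X M \<and> mat_eq (Points X) (mat_mult (Points X) M M) M \<and>
     \<not> mat_eq (Points X) M (\<lambda>_ _. 0) \<and>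
     (\<forall>K. bose_mesner X K \<and> mat_eq (Points X) (mat_mult (Points X) K K) K \<and>
          mat_eq (Points X) (mat_mult (Points X) M K) K \<longrightarrow>
          mat_eq (Points X) K (\<lambda>_ _. 0) \<or> mat_eq (Points X) K M)"

definition E_mat :: "nat \<Rightarrow> nat \<Rightarrow> nat mat" where
  "E_mat m i = (\<lambda>x y.
     if i = 0 then 1 / real m
     else if i = 1 \<and> m \<ge> 2 then of_bool (x = y) - 1 / real m
     else 0)"

definition one_class :: "nat \<Rightarrow> (nat, nat) scheme" where
  "one_class m =
    \<lparr>Points = {1..m},
     Idx = (if m \<ge> 2 then {0, 1} else {0}),
     Rel = (\<lambda>i. if i = 0 then Id_on {1..m} else {1..m} \<times> {1..m} - Id_on {1..m}),
     Idem = E_mat m\<rparr>"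

text \<open>
  Wreath product of schemes with labels \<open>{0..r}\<close> and \<open>{0..s}\<close>, where \<open>0\<close> labels the
  identity relation and the idempotent \<open>J / card Points\<close>.  The idempotents of the product
  are, in this order, \<open>E\<^sub>0 \<otimes> F\<^sub>j\<close> for \<open>0 \<le> j \<le> s\<close> and \<open>E\<^sub>i \<otimes> I\<close> for \<open>1 \<le> i \<le> r\<close>; the
  relations have adjacency matrices \<open>A\<^sub>i \<otimes> I\<close> for \<open>0 \<le> i \<le> r\<close> and \<open>J \<otimes> B\<^sub>j\<close> for
  \<open>1 \<le> j \<le> s\<close>.
\<close>

definition wreath :: "('x, nat) scheme \<Rightarrow> ('y, nat) scheme \<Rightarrow> ('x \<times> 'y, nat) scheme" where
  "wreath X Y =
    (let r = card (Idx X) - 1; s = card (Idx Y) - 1 in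
    \<lparr>Points = Points X \<times> Points Y,
     Idx = {0..r + s},
     Rel = (\<lambda>k. if k \<le> r
        then {((x, y), (x', y')). (x, x') \<in> Rel X k \<and> y \<in> Points Y \<and> y' = y}
        else {((x, y), (x', y')). x \<in> Points X \<and> x' \<in> Points X \<and> (y, y') \<in> Rel Y (k - r)}),
     Idem = (\<lambda>k. if k \<le> s then tensor (Idem X 0) (Idem Y k)
                 else tensor (Idem X (k - s)) id_mat)\<rparr>)"

definition direct_product ::
    "('x, 'i) scheme \<Rightarrow> ('y, 'j) scheme \<Rightarrow> ('x \<times> 'y, 'i \<times> 'j) scheme" where
  "direct_product X Y =
    \<lparr>Points = Points X \<times> Points Y,
     Idx = Idx X \<times> Idx Y,
     Rel = (\<lambda>(i, j). {((x, y), (x', y')). (x, x') \<in> Rel X i \<and> (y, y') \<in> Rel Y j}),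
     Idem = (\<lambda>(i, j). tensor (Idem X i) (Idem Y j))\<rparr>"

definition direct_power ::
    "nat \<Rightarrow> (nat \<Rightarrow> ('x, 'i) scheme) \<Rightarrow> (nat \<Rightarrow> 'x, nat \<Rightarrow> 'i) scheme" where
  "direct_power d X =
    \<lparr>Points = (\<Pi>\<^sub>E j\<in>{1..d}. Points (X j)),
     Idx = (\<Pi>\<^sub>E j\<in>{1..d}. Idx (X j)),
     Rel = (\<lambda>i. {(x, y). x \<in> extensional {1..d} \<and> y \<in> extensional {1..d} \<and>
                         (\<forall>j\<in>{1..d}. (x j, y j) \<in> Rel (X j) (i j))}),
     Idem = (\<lambda>i x y. \<Prod>j\<in>{1..d}. Idem (X j) (i j) (x j) (y j))\<rparr>"

definition sudoku_scheme ::
    "nat \<Rightarrow> (nat \<Rightarrow> nat) \<Rightarrow> (nat \<Rightarrow> nat) \<Rightarrow> nat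
      \<Rightarrow> ((nat \<Rightarrow> nat \<times> nat) \<times> nat, (nat \<Rightarrow> nat) \<times> nat) scheme" where
  "sudoku_scheme d a b N =
     direct_product
       (direct_power d (\<lambda>j. wreath (one_class (b j)) (one_class (a j))))
       (one_class N)"

text \<open>
  In \<open>sudoku_scheme\<close>, labels of \<open>T\<close> outside \<open>Idx X\<close> impose no condition, because their
  matrices are zero.
\<close>

definition delsarte_design :: "('x, 'i) scheme \<Rightarrow> 'i set \<Rightarrow> 'x set \<Rightarrow> bool" where
  "delsarte_design X T C \<longleftrightarrow>
     (\<forall>i\<in>T. \<forall>x\<in>Points X. mat_vec (Points X) (Idem X i) (\<lambda>y. of_bool (y \<in> C)) x = 0)"

definition low_indices :: "nat \<Rightarrow> nat set" where
  "low_indices a = {0..(if a \<ge> 2 then 1 else 0)}"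

definition sudoku_indices :: "nat \<Rightarrow> (nat \<Rightarrow> nat) \<Rightarrow> ((nat \<Rightarrow> nat) \<times> nat) set" where
  "sudoku_indices d a = (\<Pi>\<^sub>E k\<in>{1..d}. low_indices (a k)) \<times> {1}"


section \<open>The constructions yield association schemes with their primitive idempotents\<close>

definition spectral :: "('x, 'i) scheme \<Rightarrow> bool" where
  "spectral X \<longleftrightarrow>
     finite (Points X) \<and> Points X \<noteq> {} \<and> finite (Idx X) \<and>
     (\<forall>i\<in>Idx X. Rel X i \<noteq> {} \<and> Rel X i \<subseteq> Points X \<times> Points X \<and> sym (Rel X i)) \<and>
     (\<forall>x\<in>Points X. \<forall>y\<in>Points X. \<exists>!i. i \<in> Idx X \<and> (x, y) \<in> Rel X i) \<and>
     (\<exists>i\<in>Idx X. Rel X i = Id_on (Points X)) \<and>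
     (\<exists>P. \<forall>i\<in>Idx X. \<forall>x\<in>Points X. \<forall>y\<in>Points X.
        of_bool ((x, y) \<in> Rel X i) = (\<Sum>e\<in>Idx X. P i e * Idem X e x y)) \<and>
     (\<exists>Q. \<forall>e\<in>Idx X. \<forall>i\<in>Idx X. \<forall>x y. (x, y) \<in> Rel X i \<longrightarrow> Idem X e x y = Q e i) \<and>
     (\<forall>e\<in>Idx X. \<forall>f\<in>Idx X. \<forall>x\<in>Points X. \<forall>y\<in>Points X.
        (\<Sum>z\<in>Points X. Idem X e x z * Idem X f z y) = (if e = f then Idem X e x y else 0)) \<and>
     (\<forall>e\<in>Idx X. \<exists>x\<in>Points X. \<exists>y\<in>Points X. Idem X e x y \<noteq> 0)"

lemma spectralD:
  assumes "spectral X"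
  shows "finite (Points X)" "Points X \<noteq> {}" "finite (Idx X)"
    "\<And>i. i \<in> Idx X \<Longrightarrow> Rel X i \<noteq> {}"
    "\<And>i x y. i \<in> Idx X \<Longrightarrow> (x, y) \<in> Rel X i \<Longrightarrow> x \<in> Points X \<and> y \<in> Points X"
    "\<And>i x y. i \<in> Idx X \<Longrightarrow> (x, y) \<in> Rel X i \<Longrightarrow> (y, x) \<in> Rel X i"
    "\<And>x y. x \<in> Points X \<Longrightarrow> y \<in> Points X \<Longrightarrow> \<exists>i. i \<in> Idx X \<and> (x, y) \<in> Rel X i"
    "\<And>x y i j. i \<in> Idx X \<Longrightarrow> j \<in> Idx X \<Longrightarrow> (x, y) \<in> Rel X i \<Longrightarrow> (x, y) \<in> Rel X j \<Longrightarrow> i = j"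
    "\<exists>i\<in>Idx X. Rel X i = Id_on (Points X)"
    "\<exists>P. \<forall>i\<in>Idx X. \<forall>x\<in>Points X. \<forall>y\<in>Points X.
        of_bool ((x, y) \<in> Rel X i) = (\<Sum>e\<in>Idx X. P i e * Idem X e x y)"
    "\<exists>Q. \<forall>e\<in>Idx X. \<forall>i\<in>Idx X. \<forall>x y. (x, y) \<in> Rel X i \<longrightarrow> Idem X e x y = Q e i"
    "\<And>e f x y. e \<in> Idx X \<Longrightarrow> f \<in> Idx X \<Longrightarrow> x \<in> Points X \<Longrightarrow> y \<in> Points X \<Longrightarrow>
        (\<Sum>z\<in>Points X. Idem X e x z * Idem X f z y) = (if e = f then Idem X e x y else 0)"
    "\<And>e. e \<in> Idx X \<Longrightarrow> \<exists>x\<in>Points X. \<exists>y\<in>Points X. Idem X e x y \<noteq> 0"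
proof -
  note A = assms[unfolded spectral_def]
  show "finite (Points X)" "Points X \<noteq> {}" "finite (Idx X)"
    "\<And>i. i \<in> Idx X \<Longrightarrow> Rel X i \<noteq> {}"
    "\<exists>i\<in>Idx X. Rel X i = Id_on (Points X)"
    "\<exists>P. \<forall>i\<in>Idx X. \<forall>x\<in>Points X. \<forall>y\<in>Points X.
        of_bool ((x, y) \<in> Rel X i) = (\<Sum>e\<in>Idx X. P i e * Idem X e x y)"
    "\<exists>Q. \<forall>e\<in>Idx X. \<forall>i\<in>Idx X. \<forall>x y. (x, y) \<in> Rel X i \<longrightarrow> Idem X e x y = Q e i"
    "\<And>e f x y. e \<in> Idx X \<Longrightarrow> f \<in> Idx X \<Longrightarrow> x \<in> Points X \<Longrightarrow> y \<in> Points X \<Longrightarrow>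
        (\<Sum>z\<in>Points X. Idem X e x z * Idem X f z y) = (if e = f then Idem X e x y else 0)"
    "\<And>e. e \<in> Idx X \<Longrightarrow> \<exists>x\<in>Points X. \<exists>y\<in>Points X. Idem X e x y \<noteq> 0"
    using A by blast+
  show R: "\<And>i x y. i \<in> Idx X \<Longrightarrow> (x, y) \<in> Rel X i \<Longrightarrow> x \<in> Points X \<and> y \<in> Points X"
    using A by blast
  show "\<And>i x y. i \<in> Idx X \<Longrightarrow> (x, y) \<in> Rel X i \<Longrightarrow> (y, x) \<in> Rel X i"
    using A by (meson symD)
  have U: "\<forall>x\<in>Points X. \<forall>y\<in>Points X. \<exists>!i. i \<in> Idx X \<and> (x, y) \<in> Rel X i"
    using A by blast
  show "\<And>x y. x \<in> Points X \<Longrightarrow> y \<in> Points X \<Longrightarrow> \<exists>i. i \<in> Idx X \<and> (x, y) \<in> Rel X i"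
    using U by blast
  show "\<And>x y i j. i \<in> Idx X \<Longrightarrow> j \<in> Idx X \<Longrightarrow> (x, y) \<in> Rel X i \<Longrightarrow> (x, y) \<in> Rel X j \<Longrightarrow> i = j"
    using U R by blast
qed

lemma spectralI:
  assumes "finite (Points X)" "Points X \<noteq> {}" "finite (Idx X)"
    "\<And>i. i \<in> Idx X \<Longrightarrow> Rel X i \<noteq> {}"
    "\<And>i x y. i \<in> Idx X \<Longrightarrow> (x, y) \<in> Rel X i \<Longrightarrow> x \<in> Points X \<and> y \<in> Points X"
    "\<And>i x y. i \<in> Idx X \<Longrightarrow> (x, y) \<in> Rel X i \<Longrightarrow> (y, x) \<in> Rel X i"
    "\<And>x y. x \<in> Points X \<Longrightarrow> y \<in> Points X \<Longrightarrow> \<exists>i. i \<in> Idx X \<and> (x, y) \<in> Rel X i"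
    "\<And>x y i j. i \<in> Idx X \<Longrightarrow> j \<in> Idx X \<Longrightarrow> (x, y) \<in> Rel X i \<Longrightarrow> (x, y) \<in> Rel X j \<Longrightarrow> i = j"
    "\<exists>i\<in>Idx X. Rel X i = Id_on (Points X)"
    "\<And>i x y. i \<in> Idx X \<Longrightarrow> x \<in> Points X \<Longrightarrow> y \<in> Points X \<Longrightarrow>
        of_bool ((x, y) \<in> Rel X i) = (\<Sum>e\<in>Idx X. P i e * Idem X e x y)"
    "\<And>e i x y. e \<in> Idx X \<Longrightarrow> i \<in> Idx X \<Longrightarrow> (x, y) \<in> Rel X i \<Longrightarrow> Idem X e x y = Q e i"
    "\<And>e f x y. e \<in> Idx X \<Longrightarrow> f \<in> Idx X \<Longrightarrow> x \<in> Points X \<Longrightarrow> y \<in> Points X \<Longrightarrow>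
        (\<Sum>z\<in>Points X. Idem X e x z * Idem X f z y) = (if e = f then Idem X e x y else 0)"
    "\<And>e. e \<in> Idx X \<Longrightarrow> \<exists>x\<in>Points X. \<exists>y\<in>Points X. Idem X e x y \<noteq> 0"
  shows "spectral X"
  unfolding spectral_def
proof (intro conjI)
  show "\<forall>i\<in>Idx X. Rel X i \<noteq> {} \<and> Rel X i \<subseteq> Points X \<times> Points X \<and> sym (Rel X i)"
    using assms(4-6) by (force simp: sym_def)
  show "\<forall>x\<in>Points X. \<forall>y\<in>Points X. \<exists>!i. i \<in> Idx X \<and> (x, y) \<in> Rel X i"
    using assms(7,8) by blast
  show "\<exists>P. \<forall>i\<in>Idx X. \<forall>x\<in>Points X. \<forall>y\<in>Points X.
        of_bool ((x, y) \<in> Rel X i) = (\<Sum>e\<in>Idx X. P i e * Idem X e x y)"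
    using assms(10) by blast
  show "\<exists>Q. \<forall>e\<in>Idx X. \<forall>i\<in>Idx X. \<forall>x y. (x, y) \<in> Rel X i \<longrightarrow> Idem X e x y = Q e i"
    using assms(11) by blast
  show "\<forall>e\<in>Idx X. \<forall>f\<in>Idx X. \<forall>x\<in>Points X. \<forall>y\<in>Points X.
        (\<Sum>z\<in>Points X. Idem X e x z * Idem X f z y) = (if e = f then Idem X e x y else 0)"
    using assms(12) by blast
  show "\<forall>e\<in>Idx X. \<exists>x\<in>Points X. \<exists>y\<in>Points X. Idem X e x y \<noteq> 0" using assms(13) by blast
qed (use assms in blast)+

lemma sum_rel:
  assumes "spectral X" "i \<in> Idx X" "(x, y) \<in> Rel X i"
  shows "(\<Sum>k\<in>Idx X. c k * of_bool ((x, y) \<in> Rel X k)) = (c i :: real)"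
proof -
  have "(\<Sum>k\<in>Idx X. c k * of_bool ((x, y) \<in> Rel X k)) = (\<Sum>k\<in>Idx X. if k = i then c k else 0)"
    by (rule sum.cong) (use spectralD(8)[OF assms(1)] assms(2,3) in auto)
  then show ?thesis using assms spectralD(3)[OF assms(1)] by simp
qed

lemma bose_mesner_iff:
  assumes "spectral X"
  shows "bose_mesner X M \<longleftrightarrow> (\<exists>c. \<forall>i\<in>Idx X. \<forall>(x, y)\<in>Rel X i. M x y = c i)"
proof
  assume "bose_mesner X M"
  then obtain c where c: "\<forall>x\<in>Points X. \<forall>y\<in>Points X.
     M x y = (\<Sum>i\<in>Idx X. c i * of_bool ((x, y) \<in> Rel X i))"
    unfolding bose_mesner_def by blast
  have "M x y = c i" if "i \<in> Idx X" "(x, y) \<in> Rel X i" for i x y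
    using c sum_rel[OF assms that, of c] spectralD(5)[OF assms that] by simp
  then show "\<exists>c. \<forall>i\<in>Idx X. \<forall>(x, y)\<in>Rel X i. M x y = c i" by blast
next
  assume "\<exists>c. \<forall>i\<in>Idx X. \<forall>(x, y)\<in>Rel X i. M x y = c i"
  then obtain c where c: "\<And>i x y. i\<in>Idx X \<Longrightarrow> (x, y)\<in>Rel X i \<Longrightarrow> M x y = c i" by blast
  show "bose_mesner X M" unfolding bose_mesner_def
  proof (intro exI[of _ c] ballI)
    fix x y assume "x \<in> Points X" "y \<in> Points X"
    then obtain i where "i \<in> Idx X" "(x, y) \<in> Rel X i" using spectralD(7)[OF assms] by blast
    then show "M x y = (\<Sum>i\<in>Idx X. c i * of_bool ((x, y) \<in> Rel X i))"
      by (simp only: c sum_rel[OF assms])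
  qed
qed

lemma Idem_bose_mesner:
  assumes "spectral X" "e \<in> Idx X"
  shows "bose_mesner X (Idem X e)"
proof -
  obtain Q where "\<forall>e\<in>Idx X. \<forall>i\<in>Idx X. \<forall>x y. (x, y) \<in> Rel X i \<longrightarrow> Idem X e x y = Q e i"
    using spectralD(11)[OF assms(1)] by blast
  then show ?thesis unfolding bose_mesner_iff[OF assms(1)] using assms(2)
    by (intro exI[of _ "Q e"]) blast
qed

lemma bose_mesner_expand:
  assumes "spectral X" "bose_mesner X M"
  obtains c where "\<And>x y. x \<in> Points X \<Longrightarrow> y \<in> Points X \<Longrightarrow>
    M x y = (\<Sum>e\<in>Idx X. c e * Idem X e x y)"
proof -
  obtain m where m: "\<And>x y. x\<in>Points X \<Longrightarrow> y\<in>Points X \<Longrightarrow>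
     M x y = (\<Sum>i\<in>Idx X. m i * of_bool ((x, y) \<in> Rel X i))"
    using assms(2) unfolding bose_mesner_def by blast
  obtain P where P: "\<forall>i\<in>Idx X. \<forall>x\<in>Points X. \<forall>y\<in>Points X.
        of_bool ((x, y) \<in> Rel X i) = (\<Sum>e\<in>Idx X. P i e * Idem X e x y)"
    using spectralD(10)[OF assms(1)] by blast
  show thesis
  proof (rule that[of "\<lambda>e. \<Sum>i\<in>Idx X. m i * P i e"])
    fix x y assume xy: "x \<in> Points X" "y \<in> Points X"
    have "M x y = (\<Sum>i\<in>Idx X. m i * (\<Sum>e\<in>Idx X. P i e * Idem X e x y))"
      unfolding m[OF xy] by (rule sum.cong) (use P xy in auto)
    also have "\<dots> = (\<Sum>e\<in>Idx X. (\<Sum>i\<in>Idx X. m i * P i e) * Idem X e x y)"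
      unfolding sum_distrib_left sum_distrib_right
      by (subst sum.swap) (simp add: mult_ac)
    finally show "M x y = (\<Sum>e\<in>Idx X. (\<Sum>i\<in>Idx X. m i * P i e) * Idem X e x y)" .
  qed
qed

lemma Idem_mult_expand:
  assumes "spectral X" and e: "e \<in> Idx X" and xy: "x \<in> Points X" "y \<in> Points X"
    and M: "\<And>x y. x \<in> Points X \<Longrightarrow> y \<in> Points X \<Longrightarrow> M x y = (\<Sum>e\<in>Idx X. c e * Idem X e x y)"
  shows "mat_mult (Points X) (Idem X e) M x y = c e * Idem X e x y"
    "mat_mult (Points X) M (Idem X e) x y = c e * Idem X e x y"
proof -
  have "mat_mult (Points X) (Idem X e) M x y
      = (\<Sum>z\<in>Points X. \<Sum>f\<in>Idx X. c f * (Idem X e x z * Idem X f z y))"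
    unfolding mat_mult_def by (rule sum.cong) (auto simp: M xy sum_distrib_left mult_ac)
  also have "\<dots> = (\<Sum>f\<in>Idx X. c f * (\<Sum>z\<in>Points X. Idem X e x z * Idem X f z y))"
    by (subst sum.swap) (simp add: sum_distrib_left)
  also have "\<dots> = (\<Sum>f\<in>Idx X. if f = e then c e * Idem X e x y else 0)"
    by (rule sum.cong) (auto simp: spectralD(12)[OF assms(1)] e xy)
  finally show "mat_mult (Points X) (Idem X e) M x y = c e * Idem X e x y"
    using e spectralD(3)[OF assms(1)] by simp
  have "mat_mult (Points X) M (Idem X e) x y
      = (\<Sum>z\<in>Points X. \<Sum>f\<in>Idx X. c f * (Idem X f x z * Idem X e z y))"
    unfolding mat_mult_def by (rule sum.cong) (auto simp: M xy sum_distrib_left sum_distrib_right mult_ac)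
  also have "\<dots> = (\<Sum>f\<in>Idx X. c f * (\<Sum>z\<in>Points X. Idem X f x z * Idem X e z y))"
    by (subst sum.swap) (simp add: sum_distrib_left)
  also have "\<dots> = (\<Sum>f\<in>Idx X. if f = e then c e * Idem X e x y else 0)"
    by (rule sum.cong) (auto simp: spectralD(12)[OF assms(1)] e xy)
  finally show "mat_mult (Points X) M (Idem X e) x y = c e * Idem X e x y"
    using e spectralD(3)[OF assms(1)] by simp
qed

lemma mat_mult_expand:
  assumes "spectral X" and xy: "x \<in> Points X" "y \<in> Points X"
    and M: "\<And>x y. x \<in> Points X \<Longrightarrow> y \<in> Points X \<Longrightarrow> M x y = (\<Sum>e\<in>Idx X. c e * Idem X e x y)"
    and K: "\<And>x y. x \<in> Points X \<Longrightarrow> y \<in> Points X \<Longrightarrow> K x y = (\<Sum>e\<in>Idx X. k e * Idem X e x y)"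
  shows "mat_mult (Points X) M K x y = (\<Sum>e\<in>Idx X. (c e * k e) * Idem X e x y)"
proof -
  have "mat_mult (Points X) M K x y
      = (\<Sum>z\<in>Points X. \<Sum>e\<in>Idx X. c e * (Idem X e x z * K z y))"
    unfolding mat_mult_def by (rule sum.cong) (auto simp: M xy sum_distrib_left mult_ac)
  also have "\<dots> = (\<Sum>e\<in>Idx X. c e * mat_mult (Points X) (Idem X e) K x y)"
    unfolding mat_mult_def by (subst sum.swap) (simp add: sum_distrib_left)
  also have "\<dots> = (\<Sum>e\<in>Idx X. (c e * k e) * Idem X e x y)"
    by (rule sum.cong) (auto simp: Idem_mult_expand(1)[OF assms(1) _ xy K])
  finally show ?thesis .
qed

lemma bose_mesner_combination:
  assumes "spectral X"
    and M: "\<And>x y. x \<in> Points X \<Longrightarrow> y \<in> Points X \<Longrightarrow> M x y = (\<Sum>e\<in>Idx X. c e * Idem X e x y)"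
  shows "bose_mesner X M"
proof -
  obtain Q where Q: "\<forall>e\<in>Idx X. \<forall>i\<in>Idx X. \<forall>x y. (x, y) \<in> Rel X i \<longrightarrow> Idem X e x y = Q e i"
    using spectralD(11)[OF assms(1)] by blast
  have "\<forall>i\<in>Idx X. \<forall>(x, y)\<in>Rel X i. M x y = (\<Sum>e\<in>Idx X. c e * Q e i)"
  proof (clarify)
    fix i x y assume i: "i \<in> Idx X" "(x, y) \<in> Rel X i"
    show "M x y = (\<Sum>e\<in>Idx X. c e * Q e i)"
      using i Q spectralD(5)[OF assms(1) i] by (simp add: M)
  qed
  then show ?thesis unfolding bose_mesner_iff[OF assms(1)]
    by (intro exI[of _ "\<lambda>i. \<Sum>e\<in>Idx X. c e * Q e i"]) blast
qed

lemma spectral_association_scheme: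
  assumes "spectral X"
  shows "association_scheme X"
proof -
  obtain P where P: "\<forall>i\<in>Idx X. \<forall>x\<in>Points X. \<forall>y\<in>Points X.
        of_bool ((x, y) \<in> Rel X i) = (\<Sum>e\<in>Idx X. P i e * Idem X e x y)"
    using spectralD(10)[OF assms(1)] by blast
  have "\<forall>i\<in>Idx X. \<forall>j\<in>Idx X. \<forall>k\<in>Idx X. \<exists>p. \<forall>(x, y)\<in>Rel X k.
        card {z \<in> Points X. (x, z) \<in> Rel X i \<and> (z, y) \<in> Rel X j} = p"
  proof (intro ballI)
    fix i j k assume ijk: "i \<in> Idx X" "j \<in> Idx X" "k \<in> Idx X"
    let ?M = "mat_mult (Points X) (\<lambda>x y. of_bool ((x, y) \<in> Rel X i)) (\<lambda>x y. of_bool ((x, y) \<in> Rel X j))"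
    have "bose_mesner X ?M"
    proof (rule bose_mesner_combination[OF assms, where c = "\<lambda>e. P i e * P j e"])
      fix x y assume xy: "x \<in> Points X" "y \<in> Points X"
      have ex: "of_bool ((x, y) \<in> Rel X k) = (\<Sum>e\<in>Idx X. P k e * Idem X e x y)"
        if "k \<in> Idx X" "x \<in> Points X" "y \<in> Points X" for k x y using P that by blast
      show "?M x y = (\<Sum>e\<in>Idx X. P i e * P j e * Idem X e x y)"
        by (rule mat_mult_expand[OF assms xy ex[OF ijk(1)] ex[OF ijk(2)]])
    qed
    then obtain c' where "\<forall>i\<in>Idx X. \<forall>(x, y)\<in>Rel X i. ?M x y = c' i"
      unfolding bose_mesner_iff[OF assms] by (elim exE)
    then have "\<forall>(x, y)\<in>Rel X k. ?M x y = c' k" using ijk(3) by (rule bspec)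
    then obtain c where c: "\<forall>(x, y)\<in>Rel X k. ?M x y = c" by (rule that)
    have M: "?M x y = real (card {z \<in> Points X. (x, z) \<in> Rel X i \<and> (z, y) \<in> Rel X j})" for x y
    proof -
      have "?M x y = (\<Sum>z\<in>Points X. of_bool ((x, z) \<in> Rel X i \<and> (z, y) \<in> Rel X j))"
        unfolding mat_mult_def by (rule sum.cong) auto
      also have "\<dots> = real (card {z \<in> Points X. (x, z) \<in> Rel X i \<and> (z, y) \<in> Rel X j})"
        using spectralD(1)[OF assms] by (simp add: Int_def)
      finally show ?thesis .
    qed
    show "\<exists>p. \<forall>(x, y)\<in>Rel X k.
        card {z \<in> Points X. (x, z) \<in> Rel X i \<and> (z, y) \<in> Rel X j} = p"
    proof (intro exI[of _ "nat \<lfloor>c\<rfloor>"] ballI, clarify)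
      fix x y assume "(x, y) \<in> Rel X k"
      then have "c = real (card {z \<in> Points X. (x, z) \<in> Rel X i \<and> (z, y) \<in> Rel X j})"
        using c M by auto
      then show "card {z \<in> Points X. (x, z) \<in> Rel X i \<and> (z, y) \<in> Rel X j} = nat \<lfloor>c\<rfloor>"
        by simp
    qed
  qed
  then show ?thesis using assms unfolding association_scheme_def spectral_def
    by (elim conjE) (intro conjI; assumption)
qed

lemma spectral_primitive_idempotent:
  assumes sp: "spectral X"
  shows "primitive_idempotent X M \<longleftrightarrow> (\<exists>e\<in>Idx X. mat_eq (Points X) M (Idem X e))"
proof
  assume prim: "primitive_idempotent X M"
  note p = prim[unfolded primitive_idempotent_def]
  obtain c where c: "\<And>x y. x \<in> Points X \<Longrightarrow> y \<in> Points X \<Longrightarrow> M x y = (\<Sum>e\<in>Idx X. c e * Idem X e x y)"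
    using bose_mesner_expand[OF sp conjunct1[OF p]] by metis
  have "\<exists>e\<in>Idx X. c e \<noteq> 0"
  proof (rule ccontr)
    assume "\<not> (\<exists>e\<in>Idx X. c e \<noteq> 0)"
    then have "mat_eq (Points X) M (\<lambda>_ _. 0)" by (auto simp: mat_eq_def c)
    then show False using p by blast
  qed
  then obtain e where e: "e \<in> Idx X" "c e \<noteq> 0" by blast
  obtain x y where xy: "x \<in> Points X" "y \<in> Points X" "Idem X e x y \<noteq> 0"
    using spectralD(13)[OF sp e(1)] by blast
  have MM: "\<And>x y. x \<in> Points X \<Longrightarrow> y \<in> Points X \<Longrightarrow> M x y = (\<Sum>e\<in>Idx X. (c e * c e) * Idem X e x y)"
    using p mat_mult_expand[OF sp _ _ c c] by (simp add: mat_eq_def)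
  have "c e * Idem X e x y = (c e * c e) * Idem X e x y"
    using Idem_mult_expand(1)[OF sp e(1) xy(1,2) c] Idem_mult_expand(1)[OF sp e(1) xy(1,2) MM] by simp
  then have c1: "c e = 1" using xy e by simp
  have "mat_eq (Points X) (mat_mult (Points X) M (Idem X e)) (Idem X e)"
    using Idem_mult_expand(2)[OF sp e(1) _ _ c] c1 by (simp add: mat_eq_def)
  moreover have "mat_eq (Points X) (mat_mult (Points X) (Idem X e) (Idem X e)) (Idem X e)"
    using spectralD(12)[OF sp e(1) e(1)] by (simp add: mat_eq_def mat_mult_def)
  ultimately have "mat_eq (Points X) (Idem X e) (\<lambda>_ _. 0) \<or> mat_eq (Points X) (Idem X e) M"
    using p[THEN conjunct2, THEN conjunct2, THEN conjunct2, rule_format, of "Idem X e"]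
      Idem_bose_mesner[OF sp e(1)] by blast
  then show "\<exists>e\<in>Idx X. mat_eq (Points X) M (Idem X e)"
  proof
    assume "mat_eq (Points X) (Idem X e) (\<lambda>_ _. 0)"
    then show ?thesis using xy by (simp add: mat_eq_def)
  next
    assume "mat_eq (Points X) (Idem X e) M"
    then have "mat_eq (Points X) M (Idem X e)" by (simp add: mat_eq_def)
    then show ?thesis using e(1) by blast
  qed
next
  assume "\<exists>e\<in>Idx X. mat_eq (Points X) M (Idem X e)"
  then obtain e where e: "e \<in> Idx X" and Me: "\<And>x y. x \<in> Points X \<Longrightarrow> y \<in> Points X \<Longrightarrow> M x y = Idem X e x y"
    by (auto simp: mat_eq_def)
  have MK: "mat_mult (Points X) M K x y = mat_mult (Points X) (Idem X e) K x y"
    if "x \<in> Points X" for K x y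
    unfolding mat_mult_def by (rule sum.cong) (auto simp: Me that)
  show "primitive_idempotent X M" unfolding primitive_idempotent_def
  proof (intro conjI allI impI)
    show "bose_mesner X M" using Idem_bose_mesner[OF sp e] by (simp add: bose_mesner_def Me)
    show "mat_eq (Points X) (mat_mult (Points X) M M) M"
      unfolding mat_eq_def mat_mult_def
    proof (intro ballI)
      fix x y assume "x \<in> Points X" "y \<in> Points X"
      then show "(\<Sum>z\<in>Points X. M x z * M z y) = M x y"
        using spectralD(12)[OF sp e e] by (simp add: Me)
    qed
    show "\<not> mat_eq (Points X) M (\<lambda>_ _. 0)"
      using spectralD(13)[OF sp e] by (auto simp: mat_eq_def Me)
    fix K assume K: "bose_mesner X K \<and> mat_eq (Points X) (mat_mult (Points X) K K) K \<and>
          mat_eq (Points X) (mat_mult (Points X) M K) K"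
    obtain k where k: "\<And>x y. x \<in> Points X \<Longrightarrow> y \<in> Points X \<Longrightarrow> K x y = (\<Sum>e\<in>Idx X. k e * Idem X e x y)"
      using bose_mesner_expand[OF sp conjunct1[OF K]] by metis
    have K1: "K x y = k e * Idem X e x y" if "x \<in> Points X" "y \<in> Points X" for x y
      using K Idem_mult_expand(1)[OF sp e that k] MK that by (simp add: mat_eq_def)
    obtain x y where xy: "x \<in> Points X" "y \<in> Points X" "Idem X e x y \<noteq> 0"
      using spectralD(13)[OF sp e] by blast
    have "K x y = (\<Sum>z\<in>Points X. K x z * K z y)"
      using K xy by (simp add: mat_eq_def mat_mult_def)
    also have "\<dots> = k e * k e * (\<Sum>z\<in>Points X. Idem X e x z * Idem X e z y)"
      unfolding sum_distrib_left by (rule sum.cong) (auto simp: K1 xy)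
    also have "\<dots> = k e * k e * Idem X e x y" using spectralD(12)[OF sp e e xy(1,2)] by simp
    finally have "k e = 0 \<or> k e = 1" using K1 xy by auto
    then show "mat_eq (Points X) K (\<lambda>_ _. 0) \<or> mat_eq (Points X) K M"
      by (auto simp: mat_eq_def K1 Me)
  qed
qed

lemma E_mat_orthogonal:
  assumes "finite V" "card V = m" and xy: "x \<in> V" "y \<in> V"
  shows "(\<Sum>z\<in>V. E_mat m e x z * E_mat m f z y) = (if e = f then E_mat m e x y else 0)"
proof -
  have m: "m > 0" using assms card_gt_0_iff by blast
  have s: "(\<Sum>z\<in>V. of_bool (x = z) * c) = c" "(\<Sum>z\<in>V. c * of_bool (x = z)) = c"
    "(\<Sum>z\<in>V. of_bool (z = y) * c) = c" "(\<Sum>z\<in>V. c * of_bool (z = y)) = c"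
    "(\<Sum>z\<in>V. of_bool (x = z) * of_bool (z = y)) = (of_bool (x = y) :: real)" for c :: real
    using assms by (simp_all add: of_bool_def if_distrib[of "\<lambda>u. u * _"] if_distrib[of "\<lambda>u. _ * u"] cong: if_cong)
  have t: "(\<Sum>z\<in>V. (of_bool (x = z) - 1 / real m) * (of_bool (z = y) - 1 / real m))
      = of_bool (x = y) - 1 / real m"
  proof -
    have "(\<Sum>z\<in>V. (of_bool (x = z) - 1 / real m) * (of_bool (z = y) - 1 / real m))
      = (\<Sum>z\<in>V. of_bool (x = z) * of_bool (z = y)) - (\<Sum>z\<in>V. of_bool (x = z) * (1 / real m))
         - (\<Sum>z\<in>V. 1 / real m * of_bool (z = y)) + (\<Sum>z\<in>V. 1 / real m * (1 / real m))"
      by (simp add: algebra_simps sum.distrib sum_subtractf)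
    also have "\<dots> = of_bool (x = y) - 1 / real m"
      unfolding s using m assms by simp
    finally show ?thesis .
  qed
  have u: "(\<Sum>z\<in>V. (of_bool (x = z) - 1 / real m) * (1 / real m)) = 0"
    "(\<Sum>z\<in>V. 1 / real m * (of_bool (z = y) - 1 / real m)) = 0"
    using m assms s(1)[of "1 / real m"] s(4)[of "1 / real m"]
    by (simp_all only: left_diff_distrib right_diff_distrib sum_subtractf) simp_all
  have v: "(\<Sum>z\<in>V. 1 / real m * (1 / real m)) = 1 / real m" using m assms by simp
  consider "e = 0" | "e = 1" "m \<ge> 2" | "e \<noteq> 0" "\<not> (e = 1 \<and> m \<ge> 2)" by blast
  then show ?thesis
  proof cases
    case 1
    show ?thesis
      using v u(2) by (cases "f = 1 \<and> m \<ge> 2") (auto simp: 1 E_mat_def simp del: sum_constant)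
  next
    case 2
    show ?thesis using t u(1) 2 by (cases "f = 0"; cases "f = 1") (auto simp: E_mat_def)
  next
    case 3
    then show ?thesis by (auto simp: E_mat_def)
  qed
qed

lemma spectral_one_class:
  assumes "m \<ge> 1"
  shows "spectral (one_class m)"
proof -
  define V where "V = {1..m}"
  have V: "finite V" "card V = m" "V \<noteq> {}" using assms by (auto simp: V_def)
  have sel: "Points (one_class m) = V" "Idx (one_class m) = (if m \<ge> 2 then {0, 1} else {0})"
    "\<And>i. Rel (one_class m) i = (if i = 0 then Id_on V else V \<times> V - Id_on V)"
    "Idem (one_class m) = E_mat m"
    by (auto simp: one_class_def V_def)
  have ne: "V \<times> V - Id_on V \<noteq> {}" if "m \<ge> 2"
  proof -
    have "(1, 2) \<in> V \<times> V - Id_on V" using that by (auto simp: V_def)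
    then show ?thesis by blast
  qed
  have V1: "\<And>x y. m < 2 \<Longrightarrow> x \<in> V \<Longrightarrow> y \<in> V \<Longrightarrow> x = y" by (auto simp: V_def)
  show ?thesis
  proof (rule spectralI[where
      P = "\<lambda>i e. if e = 0 then (if i = 0 then 1 else real m - 1) else (if i = 0 then 1 else -1)" and
      Q = "\<lambda>e i. if e = 0 then 1 / real m else (if i = 0 then 1 else 0) - 1 / real m"],
      unfold sel)
    show "\<And>i. i \<in> (if m \<ge> 2 then {0, 1} else {0}) \<Longrightarrow>
        (if i = 0 then Id_on V else V \<times> V - Id_on V) \<noteq> {}"
      using ne V(3) by (auto split: if_splits)
    show "\<exists>i\<in>if 2 \<le> m then {0, 1::nat} else {0}. (if i = 0 then Id_on V else V \<times> V - Id_on V) = Id_on V"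
      by (rule bexI[of _ 0]) auto
    show "\<And>e. e \<in> (if 2 \<le> m then {0, 1} else {0}) \<Longrightarrow> \<exists>x\<in>V. \<exists>y\<in>V. E_mat m e x y \<noteq> 0"
    proof -
      fix e :: nat assume e: "e \<in> (if 2 \<le> m then {0, 1} else {0})"
      obtain x where x: "x \<in> V" using V by blast
      have "E_mat m e x x \<noteq> 0" using e assms by (auto simp: E_mat_def split: if_splits)
      with x show "\<exists>x\<in>V. \<exists>y\<in>V. E_mat m e x y \<noteq> 0" by blast
    qed
    show "(\<Sum>z\<in>V. E_mat m e x z * E_mat m f z y) = (if e = f then E_mat m e x y else 0)"
      if "x \<in> V" "y \<in> V" for x y e f
      by (rule E_mat_orthogonal[OF V(1,2) that])
    show "\<And>e i x y. e \<in> (if 2 \<le> m then {0, 1} else {0}) \<Longrightarrow>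
       (x, y) \<in> (if i = (0::nat) then Id_on V else V \<times> V - Id_on V) \<Longrightarrow>
       E_mat m e x y = (if e = 0 then 1 / real m else (if i = 0 then 1 else 0) - 1 / real m)"
      by (auto simp: E_mat_def split: if_splits)
    show "of_bool ((x, y) \<in> (if i = 0 then Id_on V else V \<times> V - Id_on V)) =
       (\<Sum>e\<in>(if 2 \<le> m then {0, 1} else {0}).
          (if e = 0 then (if i = 0 then 1 else real m - 1) else (if i = 0 then 1 else -1)) * E_mat m e x y)"
      if i: "i \<in> (if 2 \<le> m then {0, 1} else {0})" and xy: "x \<in> V" "y \<in> V" for i :: nat and x y
    proof (cases "m \<ge> 2")
      case True
      then show ?thesis using i xy by (cases "x = y") (auto simp: E_mat_def field_simps)
    next
      case False
      then have "m = 1" "x = y" "i = 0" using assms V1 xy i by auto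
      then show ?thesis using xy by (auto simp: E_mat_def)
    qed
    show "\<exists>i. i \<in> (if 2 \<le> m then {0, 1} else {0}) \<and> (x, y) \<in> (if i = (0::nat) then Id_on V else V \<times> V - Id_on V)"
      if "x \<in> V" "y \<in> V" for x y
    proof (cases "x = y")
      case True
      then show ?thesis using that by (intro exI[of _ 0]) auto
    next
      case False
      then have "m \<ge> 2" using V1 that by force
      then show ?thesis using that False by (intro exI[of _ 1]) auto
    qed
    show "finite V" "V \<noteq> {}" "finite (if 2 \<le> m then {0, 1::nat} else {0})" using V by auto
    show "x \<in> V \<and> y \<in> V" if "(x, y) \<in> (if i = (0::nat) then Id_on V else V \<times> V - Id_on V)" for i x y
      using that by (cases "i = 0") auto
    show "(y, x) \<in> (if i = (0::nat) then Id_on V else V \<times> V - Id_on V)"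
      if "(x, y) \<in> (if i = (0::nat) then Id_on V else V \<times> V - Id_on V)" for i x y
      using that by (cases "i = 0") auto
    show "i = j" if "i \<in> (if 2 \<le> m then {0, 1} else {0})" "j \<in> (if 2 \<le> m then {0, 1} else {0})"
      "(x, y) \<in> (if i = (0::nat) then Id_on V else V \<times> V - Id_on V)"
      "(x, y) \<in> (if j = (0::nat) then Id_on V else V \<times> V - Id_on V)" for i j x y
      using that by (cases "i = 0"; cases "j = 0") (auto split: if_splits)
  qed
qed

lemma one_class_simps:
  "Points (one_class m) = {1..m}" "Rel (one_class m) 0 = Id_on {1..m}" "Idem (one_class m) = E_mat m"
  "Idx (one_class m) = {0..card (Idx (one_class m)) - 1}"
  by (auto simp: one_class_def)

lemma tensor_apply: "tensor M K (x, y) (x', y') = M x x' * K y y'"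
  by (simp add: tensor_def)

lemma tensor_mult:
  "(\<Sum>z\<in>A \<times> B. tensor M K (x, y) z * tensor M' K' z (x', y'))
    = (\<Sum>z\<in>A. M x z * M' z x') * (\<Sum>z\<in>B. K y z * K' z y')"
  unfolding sum_product sum.cartesian_product
  by (rule sum.cong) (auto simp: tensor_def mult_ac)

lemma id_mat_mult:
  assumes "finite B" "y \<in> B"
  shows "(\<Sum>z\<in>B. id_mat y z * id_mat z y') = id_mat y y'"
  using assms by (simp add: id_mat_def of_bool_def if_distrib[of "\<lambda>u. u * _"] cong: if_cong)

lemma sum_split_shift:
  fixes h :: "nat \<Rightarrow> real"
  shows "(\<Sum>k = 0..r + s. h k) = (\<Sum>k = 0..s. h k) + (\<Sum>i = 1..r. h (i + s))"
  using sum.ub_add_nat[of 0 s h r] sum.shift_bounds_cl_nat_ivl[of h 1 s r]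
  by (simp add: add.commute)

lemma spectral_wreath:
  assumes X: "spectral X" and Y: "spectral Y"
    and IX: "Idx X = {0..card (Idx X) - 1}" and IY: "Idx Y = {0..card (Idx Y) - 1}"
    and RX: "Rel X 0 = Id_on (Points X)" and RY: "Rel Y 0 = Id_on (Points Y)"
    and EX: "\<And>x y. x \<in> Points X \<Longrightarrow> y \<in> Points X \<Longrightarrow> Idem X 0 x y = 1 / real (card (Points X))"
  shows "spectral (wreath X Y)"
proof -
  define r s m where "r = card (Idx X) - 1" and "s = card (Idx Y) - 1" and "m = real (card (Points X))"
  have m: "m > 0" using spectralD(1,2)[OF X] by (simp add: m_def card_gt_0_iff)
  have IX: "Idx X = {0..r}" and IY: "Idx Y = {0..s}" using IX IY by (simp_all add: r_def s_def)
  have EX: "\<And>x y. x \<in> Points X \<Longrightarrow> y \<in> Points X \<Longrightarrow> Idem X 0 x y = 1 / m"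
    using EX by (simp add: m_def)
  let ?R = "\<lambda>k. if k \<le> r
        then {((x, y), (x', y')). (x, x') \<in> Rel X k \<and> y \<in> Points Y \<and> y' = y}
        else {((x, y), (x', y')). x \<in> Points X \<and> x' \<in> Points X \<and> (y, y') \<in> Rel Y (k - r)}"
  let ?E = "\<lambda>k. if k \<le> s then tensor (Idem X 0) (Idem Y k)
                 else tensor (Idem X (k - s)) id_mat"
  have sel: "Points (wreath X Y) = Points X \<times> Points Y" "Idx (wreath X Y) = {0..r + s}"
    "\<And>k. Rel (wreath X Y) k = ?R k" "\<And>k. Idem (wreath X Y) k = ?E k"
    by (simp_all add: wreath_def Let_def r_def s_def)
  obtain PX where PX: "\<And>i x y. i \<le> r \<Longrightarrow> x \<in> Points X \<Longrightarrow> y \<in> Points X \<Longrightarrow>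
        of_bool ((x, y) \<in> Rel X i) = (\<Sum>e = 0..r. PX i e * Idem X e x y)"
    using spectralD(10)[OF X] by (auto simp: IX)
  obtain PY where PY: "\<And>i x y. i \<le> s \<Longrightarrow> x \<in> Points Y \<Longrightarrow> y \<in> Points Y \<Longrightarrow>
        of_bool ((x, y) \<in> Rel Y i) = (\<Sum>e = 0..s. PY i e * Idem Y e x y)"
    using spectralD(10)[OF Y] by (auto simp: IY)
  obtain QX where QX: "\<And>e i x y. e \<le> r \<Longrightarrow> i \<le> r \<Longrightarrow> (x, y) \<in> Rel X i \<Longrightarrow> Idem X e x y = QX e i"
    using spectralD(11)[OF X] by (auto simp: IX)
  obtain QY where QY: "\<And>e i x y. e \<le> s \<Longrightarrow> i \<le> s \<Longrightarrow> (x, y) \<in> Rel Y i \<Longrightarrow> Idem Y e x y = QY e i"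
    using spectralD(11)[OF Y] by (auto simp: IY)
  note dX = spectralD(5-8)[OF X, unfolded IX, simplified]
  note dY = spectralD(5-8)[OF Y, unfolded IY, simplified]
  have diagY: "y \<noteq> y'" if "(y, y') \<in> Rel Y k" "0 < k" "k \<le> s" for y y' k
    using dY(4)[of k 0 y y'] dY(1)[of k y y'] that RY by auto
  have idm: "of_bool (y' = y) = (\<Sum>e = 0..s. PY 0 e * Idem Y e y y')"
    if "y \<in> Points Y" "y' \<in> Points Y" for y y'
    using PY[of 0 y y'] that RY by (auto simp: Id_on_iff)
  show ?thesis
  proof (rule spectralI[where
      P = "\<lambda>k e. if k \<le> r then (if e \<le> s then PX k 0 * PY 0 e else PX k (e - s))
                 else (if e \<le> s then m * PY (k - r) e else 0)" and
      Q = "\<lambda>e k. if e \<le> s then QY e (if k \<le> r then 0 else k - r) / m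
                 else (if k \<le> r then QX (e - s) k else 0)"], unfold sel)
    show "finite (Points X \<times> Points Y)" "Points X \<times> Points Y \<noteq> {}"
      using spectralD(1,2)[OF X] spectralD(1,2)[OF Y] by auto
    show "finite {0..r + s}" by simp
    show "?R k \<noteq> {}" if k: "k \<in> {0..r + s}" for k
    proof (cases "k \<le> r")
      case True
      then obtain x x' where "(x, x') \<in> Rel X k" using spectralD(4)[OF X, of k] IX by fastforce
      moreover obtain y where "y \<in> Points Y" using spectralD(2)[OF Y] by blast
      ultimately have "((x, y), (x', y)) \<in> ?R k" using True by auto
      then show ?thesis by blast
    next
      case False
      then obtain y y' where "(y, y') \<in> Rel Y (k - r)"
        using spectralD(4)[OF Y, of "k - r"] IY k by fastforce
      moreover obtain x where "x \<in> Points X" using spectralD(2)[OF X] by blast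
      ultimately have "((x, y), (x, y')) \<in> ?R k" using False by auto
      then show ?thesis by blast
    qed
    show "p \<in> Points X \<times> Points Y \<and> q \<in> Points X \<times> Points Y"
      if k: "k \<in> {0..r + s}" "(p, q) \<in> ?R k" for k p q
    proof -
      obtain x y x' y' where pq: "p = (x, y)" "q = (x', y')" by (cases p; cases q)
      show ?thesis
      proof (cases "k \<le> r")
        case True
        then have "(x, x') \<in> Rel X k" "y' = y" "y \<in> Points Y" using k(2) by (simp_all add: pq)
        then show ?thesis using dX(1)[OF True] True by (simp add: pq)
      next
        case False
        then have "x \<in> Points X" "x' \<in> Points X" "(y, y') \<in> Rel Y (k - r)" using k(2) by (simp_all add: pq)
        then show ?thesis using dY(1)[of "k - r" y y'] False k(1) by (simp add: pq)
      qed
    qed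
    show "(q, p) \<in> ?R k" if k: "k \<in> {0..r + s}" "(p, q) \<in> ?R k" for k p q
    proof -
      obtain x y x' y' where pq: "p = (x, y)" "q = (x', y')" by (cases p; cases q)
      show ?thesis
      proof (cases "k \<le> r")
        case True
        then have "(x, x') \<in> Rel X k" "y' = y" "y \<in> Points Y" using k(2) by (simp_all add: pq)
        then show ?thesis using dX(2)[OF True] True by (simp add: pq)
      next
        case False
        then have "x \<in> Points X" "x' \<in> Points X" "(y, y') \<in> Rel Y (k - r)" using k(2) by (simp_all add: pq)
        then show ?thesis using dY(2)[of "k - r" y y'] False k(1) by (simp add: pq)
      qed
    qed
    show "\<exists>k. k \<in> {0..r + s} \<and> (p, q) \<in> ?R k"
      if p: "p \<in> Points X \<times> Points Y" "q \<in> Points X \<times> Points Y" for p q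
    proof -
      obtain x y x' y' where pq: "p = (x, y)" "q = (x', y')" by (cases p; cases q)
      show ?thesis
      proof (cases "y = y'")
        case True
        then obtain i where "i \<le> r" "(x, x') \<in> Rel X i" using dX(3)[of x x'] p pq by auto
        then show ?thesis using True p pq by (intro exI[of _ i]) auto
      next
        case False
        then obtain j where j: "j \<le> s" "(y, y') \<in> Rel Y j" using dY(3)[of y y'] p pq by auto
        then have "j \<noteq> 0" using False RY by (metis Id_on_iff)
        then show ?thesis using j p pq by (intro exI[of _ "j + r"]) auto
      qed
    qed
    show "k = l" if kl: "k \<in> {0..r + s}" "l \<in> {0..r + s}" "(p, q) \<in> ?R k" "(p, q) \<in> ?R l" for p q k l
    proof -
      obtain x y x' y' where pq: "p = (x, y)" "q = (x', y')" by (cases p; cases q)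
      have 1: "y = y' \<longleftrightarrow> k \<le> r"
        using kl(1,3) diagY[of y y' "k - r"] by (auto simp: pq split: if_splits)
      have 2: "y = y' \<longleftrightarrow> l \<le> r"
        using kl(2,4) diagY[of y y' "l - r"] by (auto simp: pq split: if_splits)
      show ?thesis
      proof (cases "y = y'")
        case True
        then show ?thesis using 1 2 kl dX(4)[of k l x x'] by (auto simp: pq)
      next
        case False
        then have "k - r = l - r" using 1 2 kl by (intro dY(4)[of "k - r" "l - r" y y']) (auto simp: pq)
        then show ?thesis using 1 2 False by auto
      qed
    qed
    show "\<exists>k\<in>{0..r + s}. ?R k = Id_on (Points X \<times> Points Y)"
      by (rule bexI[of _ 0]) (auto simp: RX)
    show "of_bool ((p, q) \<in> ?R k) = (\<Sum>e = 0..r + s. (if k \<le> r then (if e \<le> s then PX k 0 * PY 0 e else PX k (e - s))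
                 else (if e \<le> s then m * PY (k - r) e else 0)) * ?E e p q)"
      if k: "k \<in> {0..r + s}" and p: "p \<in> Points X \<times> Points Y" "q \<in> Points X \<times> Points Y" for k p q
    proof -
      obtain x y x' y' where pq: "p = (x, y)" "q = (x', y')" by (cases p; cases q)
      then have xy: "x \<in> Points X" "x' \<in> Points X" "y \<in> Points Y" "y' \<in> Points Y" using p by auto
      show ?thesis
      proof (cases "k \<le> r")
        case True
        have "(\<Sum>e = 0..r + s. (if e \<le> s then PX k 0 * PY 0 e else PX k (e - s)) * ?E e p q)
          = PX k 0 * Idem X 0 x x' * (\<Sum>e = 0..s. PY 0 e * Idem Y e y y')
            + (\<Sum>i = 1..r. PX k i * Idem X i x x') * of_bool (y' = y)"
          unfolding sum_split_shift sum_distrib_left sum_distrib_right pq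
          by (intro arg_cong2[of _ _ _ _ "(+)"] sum.cong) (auto simp: tensor_def id_mat_def)
        also have "\<dots> = (\<Sum>i = 0..r. PX k i * Idem X i x x') * of_bool (y' = y)"
          unfolding idm[OF xy(3,4), symmetric] by (simp add: sum.atLeast_Suc_atMost distrib_right)
        also have "\<dots> = of_bool ((p, q) \<in> ?R k)"
          unfolding PX[OF True xy(1,2), symmetric] using True xy by (auto simp: pq)
        finally show ?thesis using True by simp
      next
        case False
        have "(\<Sum>e = 0..r + s. (if e \<le> s then m * PY (k - r) e else 0) * ?E e p q)
          = m * Idem X 0 x x' * (\<Sum>e = 0..s. PY (k - r) e * Idem Y e y y')"
          unfolding sum_split_shift sum_distrib_left pq by (simp add: tensor_def mult_ac)
        also have "\<dots> = of_bool ((y, y') \<in> Rel Y (k - r))"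
          using PY[of "k - r" y y'] xy k m EX by simp
        also have "\<dots> = of_bool ((p, q) \<in> ?R k)" using False xy by (auto simp: pq)
        finally show ?thesis using False by simp
      qed
    qed
    show "?E e p q = (if e \<le> s then QY e (if k \<le> r then 0 else k - r) / m
                 else (if k \<le> r then QX (e - s) k else 0))"
      if e: "e \<in> {0..r + s}" and k: "k \<in> {0..r + s}" and pq: "(p, q) \<in> ?R k" for e k p q
    proof -
      obtain x y x' y' where p: "p = (x, y)" "q = (x', y')" by (cases p; cases q)
      show ?thesis
      proof (cases "k \<le> r")
        case True
        then have *: "(x, x') \<in> Rel X k" "y' = y" "y \<in> Points Y" using pq p by auto
        then have **: "x \<in> Points X" "x' \<in> Points X" "(y, y) \<in> Rel Y 0" using dX(1)[OF True *(1)] RY by auto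
        have "Idem X (e - s) x x' = QX (e - s) k" using QX[OF _ True *(1)] e by simp
        moreover have "Idem Y e y y = QY e 0" if "e \<le> s" using QY[OF that _ **(3)] by simp
        ultimately show ?thesis using True * ** by (simp add: p tensor_def id_mat_def EX)
      next
        case False
        then have *: "x \<in> Points X" "x' \<in> Points X" "(y, y') \<in> Rel Y (k - r)" using pq p by auto
        have "y \<noteq> y'" using diagY[OF *(3)] k False by auto
        moreover have "Idem Y e y y' = QY e (k - r)" if "e \<le> s" using QY[OF that _ *(3)] k by simp
        ultimately show ?thesis using False * by (simp add: p tensor_def id_mat_def EX)
      qed
    qed
    show "(\<Sum>z\<in>Points X \<times> Points Y. ?E e p z * ?E f z q) = (if e = f then ?E e p q else 0)"
      if e: "e \<in> {0..r + s}" and f: "f \<in> {0..r + s}"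
        and p: "p \<in> Points X \<times> Points Y" "q \<in> Points X \<times> Points Y" for e f p q
    proof -
      obtain x y x' y' where pq: "p = (x, y)" "q = (x', y')" by (cases p; cases q)
      then have xy: "x \<in> Points X" "x' \<in> Points X" "y \<in> Points Y" "y' \<in> Points Y" using p by auto
      have oX: "(\<Sum>z\<in>Points X. Idem X i x z * Idem X j z x') = (if i = j then Idem X i x x' else 0)"
        if "i \<le> r" "j \<le> r" for i j using spectralD(12)[OF X _ _ xy(1,2), of i j] IX that by auto
      have oY: "(\<Sum>z\<in>Points Y. Idem Y i y z * Idem Y j z y') = (if i = j then Idem Y i y y' else 0)"
        if "i \<le> s" "j \<le> s" for i j using spectralD(12)[OF Y _ _ xy(3,4), of i j] IY that by auto
      note oI = id_mat_mult[OF spectralD(1)[OF Y] xy(3), of y']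
      show ?thesis
        using e f unfolding pq
        by (cases "e \<le> s"; cases "f \<le> s")
          (auto simp: tensor_mult oX oY oI tensor_apply)
    qed
    show "\<exists>p\<in>Points X \<times> Points Y. \<exists>q\<in>Points X \<times> Points Y. ?E e p q \<noteq> 0" if e: "e \<in> {0..r + s}" for e
    proof (cases "e \<le> s")
      case True
      then obtain y y' where "y \<in> Points Y" "y' \<in> Points Y" "Idem Y e y y' \<noteq> 0"
        using spectralD(13)[OF Y, of e] IY by auto
      moreover obtain x where "x \<in> Points X" using spectralD(2)[OF X] by blast
      ultimately show ?thesis using True m
        by (intro bexI[of _ "(x, y)"] bexI[of _ "(x, y')"]) (auto simp: tensor_def EX)
    next
      case False
      then have "e - s \<in> Idx X" using IX e by auto
      then obtain x x' where "x \<in> Points X" "x' \<in> Points X" "Idem X (e - s) x x' \<noteq> 0"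
        using spectralD(13)[OF X] by blast
      moreover obtain y where "y \<in> Points Y" using spectralD(2)[OF Y] by blast
      ultimately show ?thesis using False
        by (intro bexI[of _ "(x, y)"] bexI[of _ "(x', y)"]) (auto simp: tensor_def id_mat_def)
    qed
  qed
qed

lemma spectral_direct_product:
  assumes X: "spectral X" and Y: "spectral Y"
  shows "spectral (direct_product X Y)"
proof -
  let ?R = "\<lambda>i j. {((x, y), (x', y')). (x, x') \<in> Rel X i \<and> (y, y') \<in> Rel Y j}"
  have sel: "Points (direct_product X Y) = Points X \<times> Points Y" "Idx (direct_product X Y) = Idx X \<times> Idx Y"
    "\<And>i j. Rel (direct_product X Y) (i, j) = ?R i j"
    "\<And>i j. Idem (direct_product X Y) (i, j) = tensor (Idem X i) (Idem Y j)"
    by (simp_all add: direct_product_def)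
  obtain PX where PX: "\<And>i x y. i \<in> Idx X \<Longrightarrow> x \<in> Points X \<Longrightarrow> y \<in> Points X \<Longrightarrow>
        of_bool ((x, y) \<in> Rel X i) = (\<Sum>e\<in>Idx X. PX i e * Idem X e x y)"
    using spectralD(10)[OF X] by auto
  obtain PY where PY: "\<And>i x y. i \<in> Idx Y \<Longrightarrow> x \<in> Points Y \<Longrightarrow> y \<in> Points Y \<Longrightarrow>
        of_bool ((x, y) \<in> Rel Y i) = (\<Sum>e\<in>Idx Y. PY i e * Idem Y e x y)"
    using spectralD(10)[OF Y] by auto
  obtain QX where QX: "\<And>e i x y. e \<in> Idx X \<Longrightarrow> i \<in> Idx X \<Longrightarrow> (x, y) \<in> Rel X i \<Longrightarrow> Idem X e x y = QX e i"
    using spectralD(11)[OF X] by auto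
  obtain QY where QY: "\<And>e i x y. e \<in> Idx Y \<Longrightarrow> i \<in> Idx Y \<Longrightarrow> (x, y) \<in> Rel Y i \<Longrightarrow> Idem Y e x y = QY e i"
    using spectralD(11)[OF Y] by auto
  show ?thesis
  proof (rule spectralI[where
      P = "\<lambda>(i, j) (e, f). PX i e * PY j f" and Q = "\<lambda>(e, f) (i, j). QX e i * QY f j"])
    show "finite (Points (direct_product X Y))" "Points (direct_product X Y) \<noteq> {}" "finite (Idx (direct_product X Y))"
      unfolding sel using spectralD(1-3)[OF X] spectralD(1-3)[OF Y] by auto
    show "Rel (direct_product X Y) k \<noteq> {}" if "k \<in> Idx (direct_product X Y)" for k
    proof -
      obtain i j where k: "k = (i, j)" by (cases k)
      then have "Rel X i \<noteq> {}" "Rel Y j \<noteq> {}"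
        using that spectralD(4)[OF X, of i] spectralD(4)[OF Y, of j] by (auto simp: sel)
      then obtain x x' y y' where "(x, x') \<in> Rel X i" "(y, y') \<in> Rel Y j" by fast
      then have "((x, y), (x', y')) \<in> ?R i j" by auto
      then show ?thesis unfolding k sel by blast
    qed
    show "p \<in> Points (direct_product X Y) \<and> q \<in> Points (direct_product X Y)"
      if "k \<in> Idx (direct_product X Y)" "(p, q) \<in> Rel (direct_product X Y) k" for k p q
      using that by (cases k) (auto simp: sel dest: spectralD(5)[OF X] spectralD(5)[OF Y])
    show "(q, p) \<in> Rel (direct_product X Y) k"
      if "k \<in> Idx (direct_product X Y)" "(p, q) \<in> Rel (direct_product X Y) k" for k p q
      using that by (cases k) (auto simp: sel intro: spectralD(6)[OF X] spectralD(6)[OF Y])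
    show "\<exists>k. k \<in> Idx (direct_product X Y) \<and> (p, q) \<in> Rel (direct_product X Y) k"
      if "p \<in> Points (direct_product X Y)" "q \<in> Points (direct_product X Y)" for p q
    proof -
      obtain x y x' y' where pq: "p = (x, y)" "q = (x', y')" by (cases p; cases q)
      have "x \<in> Points X" "x' \<in> Points X" "y \<in> Points Y" "y' \<in> Points Y"
        using that by (simp_all add: sel pq)
      then obtain i j where "i \<in> Idx X" "(x, x') \<in> Rel X i" "j \<in> Idx Y" "(y, y') \<in> Rel Y j"
        using spectralD(7)[OF X, of x x'] spectralD(7)[OF Y, of y y'] by blast
      then show ?thesis by (intro exI[of _ "(i, j)"]) (auto simp: sel pq)
    qed
    show "k = l" if "k \<in> Idx (direct_product X Y)" "l \<in> Idx (direct_product X Y)"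
      "(p, q) \<in> Rel (direct_product X Y) k" "(p, q) \<in> Rel (direct_product X Y) l" for p q k l
      using that by (cases k; cases l) (auto simp: sel dest: spectralD(8)[OF X] spectralD(8)[OF Y])
    show "\<exists>k\<in>Idx (direct_product X Y). Rel (direct_product X Y) k = Id_on (Points (direct_product X Y))"
    proof -
      obtain i j where "i \<in> Idx X" "Rel X i = Id_on (Points X)" "j \<in> Idx Y" "Rel Y j = Id_on (Points Y)"
        using spectralD(9)[OF X] spectralD(9)[OF Y] by blast
      then show ?thesis by (intro bexI[of _ "(i, j)"]) (auto simp: sel)
    qed
    show "of_bool ((p, q) \<in> Rel (direct_product X Y) k) =
        (\<Sum>e\<in>Idx (direct_product X Y). (case k of (i, j) \<Rightarrow> \<lambda>(e, f). PX i e * PY j f) e * Idem (direct_product X Y) e p q)"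
      if k: "k \<in> Idx (direct_product X Y)" and p: "p \<in> Points (direct_product X Y)" "q \<in> Points (direct_product X Y)" for k p q
    proof -
      obtain x y x' y' i j where pq: "p = (x, y)" "q = (x', y')" "k = (i, j)" by (cases p; cases q; cases k)
      then have xy: "x \<in> Points X" "x' \<in> Points X" "y \<in> Points Y" "y' \<in> Points Y" "i \<in> Idx X" "j \<in> Idx Y"
        using p k by (auto simp: sel)
      have "of_bool ((p, q) \<in> Rel (direct_product X Y) k) = of_bool ((x, x') \<in> Rel X i) * (of_bool ((y, y') \<in> Rel Y j) :: real)"
        by (simp add: pq sel)
      also have "\<dots> = (\<Sum>(e, f)\<in>Idx X \<times> Idx Y. (PX i e * Idem X e x x') * (PY j f * Idem Y f y y'))"
        unfolding PX[OF xy(5,1,2)] PY[OF xy(6,3,4)] sum_product sum.cartesian_product ..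
      also have "\<dots> = (\<Sum>e\<in>Idx X \<times> Idx Y. (case k of (i, j) \<Rightarrow> \<lambda>(e, f). PX i e * PY j f) e * Idem (direct_product X Y) e p q)"
        by (rule sum.cong) (auto simp: pq sel tensor_def)
      finally show ?thesis unfolding sel .
    qed
    show "Idem (direct_product X Y) g p q = (case g of (e, f) \<Rightarrow> \<lambda>(i, j). QX e i * QY f j) k"
      if "g \<in> Idx (direct_product X Y)" "k \<in> Idx (direct_product X Y)" "(p, q) \<in> Rel (direct_product X Y) k" for g k p q
      using that by (cases g; cases k) (auto simp: sel tensor_def QX QY)
    show "(\<Sum>z\<in>Points (direct_product X Y). Idem (direct_product X Y) g p z * Idem (direct_product X Y) h z q)
        = (if g = h then Idem (direct_product X Y) g p q else 0)"
      if "g \<in> Idx (direct_product X Y)" "h \<in> Idx (direct_product X Y)"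
        "p \<in> Points (direct_product X Y)" "q \<in> Points (direct_product X Y)" for g h p q
      using that by (cases g; cases h; cases p; cases q)
        (auto simp: sel tensor_mult spectralD(12)[OF X] spectralD(12)[OF Y] tensor_apply)
    show "\<exists>p\<in>Points (direct_product X Y). \<exists>q\<in>Points (direct_product X Y). Idem (direct_product X Y) g p q \<noteq> 0"
      if "g \<in> Idx (direct_product X Y)" for g
    proof -
      obtain e f where g: "g = (e, f)" by (cases g)
      then have "e \<in> Idx X" "f \<in> Idx Y" using that by (simp_all add: sel)
      then obtain x x' y y' where "x \<in> Points X" "x' \<in> Points X" "Idem X e x x' \<noteq> 0"
        "y \<in> Points Y" "y' \<in> Points Y" "Idem Y f y y' \<noteq> 0"
        using spectralD(13)[OF X, of e] spectralD(13)[OF Y, of f] by blast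
      then show ?thesis unfolding g
        by (intro bexI[of _ "(x, y)"] bexI[of _ "(x', y')"]) (auto simp: sel tensor_def)
    qed
  qed
qed

lemma spectral_direct_power:
  assumes X: "\<And>j. j \<in> {1..d} \<Longrightarrow> spectral (X j)"
  shows "spectral (direct_power d X)"
proof -
  define J where "J = {1..d}"
  have J: "finite J" by (simp add: J_def)
  have X: "\<And>j. j \<in> J \<Longrightarrow> spectral (X j)" using X by (simp add: J_def)
  let ?V = "\<Pi>\<^sub>E j\<in>J. Points (X j)" and ?I = "\<Pi>\<^sub>E j\<in>J. Idx (X j)"
  let ?R = "\<lambda>i. {(x, y). x \<in> extensional J \<and> y \<in> extensional J \<and> (\<forall>j\<in>J. (x j, y j) \<in> Rel (X j) (i j))}"
  let ?E = "\<lambda>i x y. \<Prod>j\<in>J. Idem (X j) (i j) (x j) (y j)"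
  have sel: "Points (direct_power d X) = ?V" "Idx (direct_power d X) = ?I"
    "\<And>i. Rel (direct_power d X) i = ?R i" "\<And>i. Idem (direct_power d X) i = ?E i"
    by (simp_all add: direct_power_def J_def)
  have ob: "of_bool (\<forall>j\<in>J. Q j) = (\<Prod>j\<in>J. of_bool (Q j) :: real)" for Q
    using J by (induction J rule: finite_induct) auto
  have "\<forall>j\<in>J. \<exists>P. \<forall>i\<in>Idx (X j). \<forall>x\<in>Points (X j). \<forall>y\<in>Points (X j).
      of_bool ((x, y) \<in> Rel (X j) i) = (\<Sum>e\<in>Idx (X j). P i e * Idem (X j) e x y)"
    using spectralD(10)[OF X] by blast
  then obtain P where P: "\<And>j i x y. j \<in> J \<Longrightarrow> i \<in> Idx (X j) \<Longrightarrow> x \<in> Points (X j) \<Longrightarrow> y \<in> Points (X j) \<Longrightarrow>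
      of_bool ((x, y) \<in> Rel (X j) i) = (\<Sum>e\<in>Idx (X j). P j i e * Idem (X j) e x y)"
    by (subst (asm) bchoice_iff) blast
  have "\<forall>j\<in>J. \<exists>Q. \<forall>e\<in>Idx (X j). \<forall>i\<in>Idx (X j). \<forall>x y. (x, y) \<in> Rel (X j) i \<longrightarrow> Idem (X j) e x y = Q e i"
    using spectralD(11)[OF X] by blast
  then obtain Q where Q: "\<And>j e i x y. j \<in> J \<Longrightarrow> e \<in> Idx (X j) \<Longrightarrow> i \<in> Idx (X j) \<Longrightarrow>
      (x, y) \<in> Rel (X j) i \<Longrightarrow> Idem (X j) e x y = Q j e i"
    by (subst (asm) bchoice_iff) blast
  show ?thesis
  proof (rule spectralI[where
      P = "\<lambda>i e. \<Prod>j\<in>J. P j (i j) (e j)" and Q = "\<lambda>e i. \<Prod>j\<in>J. Q j (e j) (i j)"], unfold sel)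
    show "finite ?V" "finite ?I" using spectralD(1,3)[OF X] J by (auto intro!: finite_PiE)
    show "?V \<noteq> {}" using spectralD(2)[OF X] by (simp add: PiE_eq_empty_iff)
    show "?R i \<noteq> {}" if i: "i \<in> ?I" for i
    proof -
      have "\<forall>j\<in>J. \<exists>p. p \<in> Rel (X j) (i j)" using spectralD(4)[OF X] i by blast
      then obtain p where "\<forall>j\<in>J. p j \<in> Rel (X j) (i j)" by (subst (asm) bchoice_iff) blast
      then have "(\<lambda>j\<in>J. fst (p j), \<lambda>j\<in>J. snd (p j)) \<in> ?R i" by simp
      then show ?thesis by blast
    qed
    show "x \<in> ?V \<and> y \<in> ?V" if "i \<in> ?I" "(x, y) \<in> ?R i" for i x y
      using that spectralD(5)[OF X] unfolding PiE_iff by blast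
    show "(y, x) \<in> ?R i" if "i \<in> ?I" "(x, y) \<in> ?R i" for i x y
      using that spectralD(6)[OF X] unfolding PiE_iff by blast
    show "\<exists>i. i \<in> ?I \<and> (x, y) \<in> ?R i" if xy: "x \<in> ?V" "y \<in> ?V" for x y
    proof -
      have "\<forall>j\<in>J. \<exists>i. i \<in> Idx (X j) \<and> (x j, y j) \<in> Rel (X j) i"
        using xy spectralD(7)[OF X] by blast
      then obtain i where "\<forall>j\<in>J. i j \<in> Idx (X j) \<and> (x j, y j) \<in> Rel (X j) (i j)"
        by (subst (asm) bchoice_iff) blast
      then show ?thesis using xy by (intro exI[of _ "restrict i J"]) (auto simp: PiE_iff)
    qed
    show "i = k" if "i \<in> ?I" "k \<in> ?I" "(x, y) \<in> ?R i" "(x, y) \<in> ?R k" for x y i k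
    proof (rule PiE_ext[OF that(1,2)])
      fix j assume "j \<in> J"
      then show "i j = k j" using that by (intro spectralD(8)[OF X, of j _ _ "x j" "y j"]) auto
    qed
    show "\<exists>i\<in>?I. ?R i = Id_on ?V"
    proof -
      have "\<forall>j\<in>J. \<exists>i. i \<in> Idx (X j) \<and> Rel (X j) i = Id_on (Points (X j))"
        using spectralD(9)[OF X] by blast
      then obtain i where i: "\<forall>j\<in>J. i j \<in> Idx (X j) \<and> Rel (X j) (i j) = Id_on (Points (X j))"
        by (subst (asm) bchoice_iff) blast
      have "?R (restrict i J) = Id_on ?V"
      proof (intro set_eqI iffI; clarify)
        fix x y assume "x \<in> extensional J" "y \<in> extensional J"
          "\<forall>j\<in>J. (x j, y j) \<in> Rel (X j) (restrict i J j)"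
        moreover from this have "x = y"
          by (intro extensionalityI[of x J y]) (use i in auto)
        ultimately show "(x, y) \<in> Id_on ?V" using i by (auto simp: PiE_iff Id_on_iff)
      next
        fix x assume "x \<in> ?V"
        then show "x \<in> extensional J \<and> x \<in> extensional J \<and> (\<forall>j\<in>J. (x j, x j) \<in> Rel (X j) (restrict i J j))"
          using i by (auto simp: PiE_iff)
      qed
      then show ?thesis using i by (intro bexI[of _ "restrict i J"]) auto
    qed
    show "of_bool ((x, y) \<in> ?R i) = (\<Sum>e\<in>?I. (\<Prod>j\<in>J. P j (i j) (e j)) * ?E e x y)"
      if i: "i \<in> ?I" and xy: "x \<in> ?V" "y \<in> ?V" for i x y
    proof -
      have "of_bool ((x, y) \<in> ?R i) = (\<Prod>j\<in>J. of_bool ((x j, y j) \<in> Rel (X j) (i j)) :: real)"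
        using xy by (auto simp: ob[symmetric] PiE_iff)
      also have "\<dots> = (\<Prod>j\<in>J. \<Sum>e\<in>Idx (X j). P j (i j) e * Idem (X j) e (x j) (y j))"
        by (rule prod.cong[OF refl], rule P) (use i xy in auto)
      also have "\<dots> = (\<Sum>e\<in>?I. \<Prod>j\<in>J. P j (i j) (e j) * Idem (X j) (e j) (x j) (y j))"
        by (rule prod_sum_PiE) (use J spectralD(3)[OF X] in auto)
      finally show ?thesis by (simp add: prod.distrib)
    qed
    show "?E e x y = (\<Prod>j\<in>J. Q j (e j) (i j))" if "e \<in> ?I" "i \<in> ?I" "(x, y) \<in> ?R i" for e i x y
      by (rule prod.cong) (use that in \<open>auto intro!: Q\<close>)
    show "(\<Sum>z\<in>?V. ?E e x z * ?E f z y) = (if e = f then ?E e x y else 0)"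
      if e: "e \<in> ?I" "f \<in> ?I" and xy: "x \<in> ?V" "y \<in> ?V" for e f x y
    proof -
      have "(\<Sum>z\<in>?V. ?E e x z * ?E f z y)
        = (\<Prod>j\<in>J. \<Sum>z\<in>Points (X j). Idem (X j) (e j) (x j) z * Idem (X j) (f j) z (y j))"
        by (subst prod_sum_PiE) (use J spectralD(1)[OF X] in \<open>auto simp: prod.distrib\<close>)
      also have "\<dots> = (\<Prod>j\<in>J. if e j = f j then Idem (X j) (e j) (x j) (y j) else 0)"
        by (rule prod.cong) (use e xy spectralD(12)[OF X] in \<open>auto simp: PiE_iff\<close>)
      also have "\<dots> = (if e = f then ?E e x y else 0)"
      proof (cases "e = f")
        case False
        then obtain j where "j \<in> J" "e j \<noteq> f j" using PiE_ext[OF e] by blast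
        then show ?thesis using False J by (auto intro!: prod_zero)
      qed simp
      finally show ?thesis .
    qed
    show "\<exists>x\<in>?V. \<exists>y\<in>?V. ?E e x y \<noteq> 0" if e: "e \<in> ?I" for e
    proof -
      have "\<forall>j\<in>J. \<exists>p. fst p \<in> Points (X j) \<and> snd p \<in> Points (X j) \<and> Idem (X j) (e j) (fst p) (snd p) \<noteq> 0"
        using spectralD(13)[OF X] e by fastforce
      then obtain p where p: "\<forall>j\<in>J. fst (p j) \<in> Points (X j) \<and> snd (p j) \<in> Points (X j) \<and>
          Idem (X j) (e j) (fst (p j)) (snd (p j)) \<noteq> 0"
        by (subst (asm) bchoice_iff) blast
      then show ?thesis using J
        by (intro bexI[of _ "\<lambda>j\<in>J. fst (p j)"] bexI[of _ "\<lambda>j\<in>J. snd (p j)"]) auto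
    qed
  qed
qed

lemma spectral_sudoku_scheme:
  assumes "\<And>j. j \<in> {1..d} \<Longrightarrow> a j \<ge> 1 \<and> b j \<ge> 1" "N \<ge> 1"
  shows "spectral (sudoku_scheme d a b N)"
  unfolding sudoku_scheme_def
proof (intro spectral_direct_product spectral_direct_power spectral_one_class)
  fix j assume j: "j \<in> {1..d}"
  have "spectral (one_class (a j))" "spectral (one_class (b j))"
    using assms(1)[OF j] spectral_one_class by blast+
  then show "spectral (wreath (one_class (b j)) (one_class (a j)))"
    by (intro spectral_wreath one_class_simps(4)) (simp_all add: one_class_simps(1-3) E_mat_def)
qed (rule assms(2))

theorem association_scheme_sudoku_scheme:
  assumes "\<And>j. j \<in> {1..d} \<Longrightarrow> a j \<ge> 1 \<and> b j \<ge> 1" "N \<ge> 1"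
  shows "association_scheme (sudoku_scheme d a b N)"
  by (intro spectral_association_scheme spectral_sudoku_scheme assms)

theorem primitive_idempotent_sudoku_scheme:
  fixes a b :: "nat \<Rightarrow> nat" and d N :: nat
  assumes "\<And>j. j \<in> {1..d} \<Longrightarrow> a j \<ge> 1 \<and> b j \<ge> 1" "N \<ge> 1"
  defines "X \<equiv> sudoku_scheme d a b N"
  shows "primitive_idempotent X M \<longleftrightarrow> (\<exists>i\<in>Idx X. mat_eq (Points X) M (Idem X i))"
  unfolding X_def by (intro spectral_primitive_idempotent spectral_sudoku_scheme assms)

text \<open>
  The labels of a wreath factor: for \<open>a \<ge> 2\<close> they are those of \<open>F\<^sub>0, F\<^sub>1, F\<^sub>2\<close>, and for
  \<open>a = 1\<close> the idempotent \<open>E\<^sub>1 \<otimes> I\<close> is relabelled from \<open>2\<close> to \<open>1\<close>.  For \<open>b = 1\<close> the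
  matrix \<open>E_mat b 1\<close> is zero.
\<close>

lemma Idem_factor:
  defines "F \<equiv> \<lambda>a b. Idem (wreath (one_class b) (one_class a))"
  shows "F a b 0 = tensor (E_mat b 0) (E_mat a 0)"
    and "a \<ge> 2 \<Longrightarrow> F a b 1 = tensor (E_mat b 0) (E_mat a 1)"
    and "a \<ge> 2 \<Longrightarrow> F a b 2 = tensor (E_mat b 1) id_mat"
    and "a = 1 \<Longrightarrow> F a b 1 = tensor (E_mat b 1) id_mat"
    and "a = 1 \<Longrightarrow> F a b 2 = (\<lambda>_ _. 0)"
    and "E_mat 1 1 = (\<lambda>_ _. 0)"
  by (auto simp: F_def wreath_def one_class_def Let_def tensor_def E_mat_def fun_eq_iff)

lemma Idem_sudoku_scheme:
  "Idem (sudoku_scheme d a b N) (f, i) (x, s) (y, t) =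
     (\<Prod>j\<in>{1..d}. Idem (wreath (one_class (b j)) (one_class (a j))) (f j) (x j) (y j)) * E_mat N i s t"
  by (simp add: sudoku_scheme_def direct_product_def direct_power_def one_class_def tensor_def)

end

theory Submission
  imports Defs
begin

text \<open>
  The idempotents with labels in \<open>\<I>\<^sub>1 \<times> \<dots> \<times> \<I>\<^sub>d \<times> {1}\<close> see a point of \<open>\<Omega>\<close> only through the
  Cartesian block that contains it and its symbol: in the \<open>j\<close>th factor they are
  \<open>(J / b\<^sub>j) \<otimes> E\<^sub>i\<close> with \<open>E\<^sub>i\<close> acting on the set of groups, and on the symbols they are
  \<open>I - J / N\<close>.  Applied to \<open>\<chi>\<close>, such an idempotent therefore yields a combination of the
  deviations \<open>D \<tau> s = c \<tau> s - K \<tau> / N\<close>, where \<open>\<tau>\<close> runs over the blocks, \<open>c \<tau> s\<close> counts the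
  occurrences of the symbol \<open>s\<close> in the block \<open>\<tau>\<close>, and \<open>K \<tau>\<close> is the number of cells of \<open>\<tau>\<close>
  (\<open>mat_vec_low_idempotent\<close>).  Since \<open>b\<^sub>1 \<cdots> b\<^sub>d = n\<^sup>d / n = N\<close>, every block has \<open>N\<close> cells,
  so \<open>D \<tau> s = c \<tau> s - 1\<close>, and the Sudoku property says precisely that all deviations vanish
  (\<open>each_symbol_once_iff_deviation\<close>).

  Vanishing deviations clearly give a design.  Conversely, for fixed \<open>j\<close> the matrices \<open>E\<^sub>i\<close>
  with \<open>i \<in> \<I>\<^sub>j\<close> add up to the identity on the groups (\<open>sum_E_mat_low_indices\<close>).  Adding up the
  design conditions over all of \<open>\<I>\<^sub>1 \<times> \<dots> \<times> \<I>\<^sub>d\<close> thus leaves a nonzero multiple of the single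
  deviation \<open>D \<tau> s\<close>, where \<open>\<tau>\<close> is the block of the point at which the conditions are evaluated.
\<close>

section \<open>Idempotents of low index\<close>

text \<open>
  For \<open>m = 1\<close> both sides are \<open>0\<close>, so the degenerate case \<open>N = 1\<close> needs no separate treatment.
\<close>

lemma E_mat_1:
  assumes "x \<in> {1..m}" "y \<in> {1..m}"
  shows "E_mat m 1 x y = of_bool (x = y) - 1 / real m"
proof (cases "m = 1")
  case True
  then show ?thesis using assms by (simp add: E_mat_def)
next
  case False
  then show ?thesis using assms by (auto simp: E_mat_def)
qed

text \<open>
  The labels \<open>0\<close> and \<open>1\<close> select the idempotents \<open>E\<^sub>0 \<otimes> E\<^sub>i\<close>.  For \<open>a = 1\<close> the label \<open>1\<close> is taken
  by \<open>E\<^sub>1 \<otimes> I\<close> instead, which is why \<open>low_indices 1\<close> excludes it.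
\<close>

lemma Idem_wreath_low:
  assumes "i \<in> low_indices a"
  shows "Idem (wreath (one_class b) (one_class a)) i p q = E_mat a i (snd p) (snd q) / real b"
proof (cases "i = 0")
  case True
  then show ?thesis by (simp add: Idem_factor(1) tensor_def E_mat_def split: prod.split)
next
  case False
  with assms have "i = 1" "a \<ge> 2" by (auto simp: low_indices_def split: if_splits)
  then show ?thesis using Idem_factor(2)[of a b]
    by (simp add: tensor_def E_mat_def split: prod.split)
qed

lemma sum_E_mat_low_indices:
  assumes "x \<in> {1..a}" "y \<in> {1..a}"
  shows "(\<Sum>i\<in>low_indices a. E_mat a i x y) = of_bool (x = y)"
proof (cases "a \<ge> 2")
  case True
  then have "low_indices a = {0, 1}" by (auto simp: low_indices_def)
  then show ?thesis using True by (simp add: E_mat_def)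
next
  case False
  then show ?thesis using assms by (auto simp: low_indices_def E_mat_def)
qed

section \<open>Cartesian blocks and deviations\<close>

definition block_label :: "nat \<Rightarrow> (nat \<Rightarrow> nat \<Rightarrow> nat \<times> nat) \<Rightarrow> (nat \<Rightarrow> nat) \<Rightarrow> nat \<Rightarrow> nat" where
  "block_label d \<phi> y = (\<lambda>j\<in>{1..d}. snd (\<phi> j (y j)))"

definition block ::
    "nat \<Rightarrow> nat \<Rightarrow> (nat \<Rightarrow> nat \<Rightarrow> nat \<times> nat) \<Rightarrow> (nat \<Rightarrow> nat) \<Rightarrow> (nat \<Rightarrow> nat) set" where
  "block n d \<phi> \<tau> = {y \<in> cells n d. block_label d \<phi> y = \<tau>}"

text \<open>
  The number of occurrences of \<open>s\<close> in \<open>B\<close> minus the average \<open>card B / N\<close>, written as a sum over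
  cells because this is the form in which it arises from a matrix-vector product.
\<close>

definition deviation ::
    "nat \<Rightarrow> ((nat \<Rightarrow> nat) \<Rightarrow> nat) \<Rightarrow> (nat \<Rightarrow> nat) set \<Rightarrow> nat \<Rightarrow> real" where
  "deviation N H B s = (\<Sum>y\<in>B. of_bool (s = H y) - 1 / real N)"

lemma finite_cells: "finite (cells n d)"
  by (simp add: cells_def finite_PiE)

lemma finite_block: "finite (block n d \<phi> \<tau>)"
  using finite_cells by (simp add: block_def)

lemma each_symbol_once_iff_deviation:
  assumes "finite B" "card B = N" "N \<ge> 1"
  shows "each_symbol_once {1..N} H B \<longleftrightarrow> (\<forall>s\<in>{1..N}. deviation N H B s = 0)"
proof -
  have "(\<exists>!x. x \<in> B \<and> H x = s) \<longleftrightarrow> deviation N H B s = 0" for s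
  proof -
    have "(\<exists>!x. x \<in> B \<and> H x = s) \<longleftrightarrow> card {x \<in> B. H x = s} = 1"
      by (auto simp: card_1_singleton_iff set_eq_iff) metis+
    moreover have "deviation N H B s = real (card {x \<in> B. H x = s}) - 1"
    proof -
      have "(\<Sum>y\<in>B. of_bool (s = H y)) = real (card {x \<in> B. H x = s})"
        using assms(1) by (simp add: Int_def eq_commute[of s])
      then show ?thesis using assms(2,3) by (simp add: deviation_def sum_subtractf)
    qed
    ultimately show ?thesis by simp
  qed
  then show ?thesis by (simp add: each_symbol_once_def)
qed

text \<open>
  Under the identification the prescribed groups become the fibres of the second component,
  which turns Cartesian blocks into fibres of \<open>block_label\<close>.
\<close>

lemma groups_eq_fibres:
  assumes "group_partition n a b G" "identification n a b G \<psi>"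
  shows "G = (\<lambda>t. {c \<in> {1..n}. snd (\<psi> c) = t}) ` {1..a}"
proof -
  have bij: "bij_betw \<psi> {1..n} ({1..b} \<times> {1..a})"
    and img: "(\<lambda>g. \<psi> ` g) ` G = (\<lambda>t. {1..b} \<times> {t}) ` {1..a}"
    using assms(2) by (auto simp: identification_def)
  have sub: "g \<subseteq> {1..n}" if "g \<in> G" for g
    using assms(1) that by (auto simp: group_partition_def partition_on_def)
  have grp: "g = {c \<in> {1..n}. snd (\<psi> c) = t}" if "g \<subseteq> {1..n}" "\<psi> ` g = {1..b} \<times> {t}" for g t
  proof (intro set_eqI iffI)
    fix c assume c: "c \<in> g"
    then have "\<psi> c \<in> {1..b} \<times> {t}" unfolding that(2)[symmetric] by (rule imageI)
    then show "c \<in> {c \<in> {1..n}. snd (\<psi> c) = t}" using that(1) c by auto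
  next
    fix c assume c: "c \<in> {c \<in> {1..n}. snd (\<psi> c) = t}"
    then have "\<psi> c \<in> {1..b} \<times> {1..a}" using bij_betwE[OF bij] by blast
    then have "\<psi> c \<in> {1..b} \<times> {t}" using c by (simp add: mem_Times_iff)
    then have "\<psi> c \<in> \<psi> ` g" using that(2) by simp
    then show "c \<in> g"
      using c that(1) inj_on_image_mem_iff[OF bij_betw_imp_inj_on[OF bij]] by blast
  qed
  show ?thesis
  proof (intro set_eqI iffI)
    fix g assume g: "g \<in> G"
    then have "\<psi> ` g \<in> (\<lambda>t. {1..b} \<times> {t}) ` {1..a}" unfolding img[symmetric] by (rule imageI)
    then obtain t where "t \<in> {1..a}" "\<psi> ` g = {1..b} \<times> {t}" by (rule imageE)
    then show "g \<in> (\<lambda>t. {c \<in> {1..n}. snd (\<psi> c) = t}) ` {1..a}"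
      by (intro image_eqI[of _ _ t] grp[OF sub[OF g]])
  next
    fix g assume "g \<in> (\<lambda>t. {c \<in> {1..n}. snd (\<psi> c) = t}) ` {1..a}"
    then obtain t where t: "t \<in> {1..a}" "g = {c \<in> {1..n}. snd (\<psi> c) = t}" by blast
    then have "{1..b} \<times> {t} \<in> (\<lambda>g. \<psi> ` g) ` G" unfolding img by blast
    then obtain g' where g': "g' \<in> G" "\<psi> ` g' = {1..b} \<times> {t}" by (metis imageE)
    then have "g' = g" unfolding t(2) by (intro grp sub)
    then show "g \<in> G" using g'(1) by simp
  qed
qed

lemma card_group:
  assumes "identification n a b G \<psi>" "t \<in> {1..a}"
  shows "card {c \<in> {1..n}. snd (\<psi> c) = t} = b"
proof -
  have bij: "bij_betw \<psi> {1..n} ({1..b} \<times> {1..a})"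
    using assms(1) by (simp add: identification_def)
  have "\<psi> ` {c \<in> {1..n}. snd (\<psi> c) = t} = {p \<in> \<psi> ` {1..n}. snd p = t}" by auto
  also have "\<dots> = {1..b} \<times> {t}"
    unfolding bij_betw_imp_surj_on[OF bij] using assms(2) by auto
  finally have "card (\<psi> ` {c \<in> {1..n}. snd (\<psi> c) = t}) = b" by simp
  moreover have "inj_on \<psi> {c \<in> {1..n}. snd (\<psi> c) = t}"
    using bij_betw_imp_inj_on[OF bij] by (rule inj_on_subset) auto
  ultimately show ?thesis by (simp add: card_image)
qed

lemma block_PiE:
  assumes "\<tau> \<in> extensional {1..d}"
  shows "block n d \<phi> \<tau> = (\<Pi>\<^sub>E j\<in>{1..d}. {c \<in> {1..n}. snd (\<phi> j c) = \<tau> j})"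
proof -
  have "block_label d \<phi> y = \<tau> \<longleftrightarrow> (\<forall>j\<in>{1..d}. snd (\<phi> j (y j)) = \<tau> j)" for y
    using assms by (auto simp: block_label_def fun_eq_iff extensional_def)
  then show ?thesis
    unfolding set_eq_iff block_def cells_def mem_Collect_eq PiE_iff by blast
qed

lemma cartesian_blocks_eq:
  assumes "\<And>j. j \<in> {1..d} \<Longrightarrow> group_partition n (a j) (b j) (P j)"
    and "\<And>j. j \<in> {1..d} \<Longrightarrow> identification n (a j) (b j) (P j) (\<phi> j)"
  shows "cartesian_blocks d P = block n d \<phi> ` (\<Pi>\<^sub>E j\<in>{1..d}. {1..a j})"
proof -
  have G: "P j = (\<lambda>t. {c \<in> {1..n}. snd (\<phi> j c) = t}) ` {1..a j}" if "j \<in> {1..d}" for j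
    using groups_eq_fibres assms that by blast
  show ?thesis
  proof (intro set_eqI iffI)
    fix B assume "B \<in> cartesian_blocks d P"
    then obtain g where B: "B = Pi\<^sub>E {1..d} g" and g: "\<forall>j\<in>{1..d}. g j \<in> P j"
      by (auto simp: cartesian_blocks_def)
    have "\<forall>j\<in>{1..d}. \<exists>t. t \<in> {1..a j} \<and> g j = {c \<in> {1..n}. snd (\<phi> j c) = t}"
      using g G by blast
    then obtain t where
      t: "\<forall>j\<in>{1..d}. t j \<in> {1..a j} \<and> g j = {c \<in> {1..n}. snd (\<phi> j c) = t j}"
      by (subst (asm) bchoice_iff) blast
    have "B = block n d \<phi> (restrict t {1..d})"
      unfolding B by (subst block_PiE) (use t in \<open>auto intro!: PiE_cong\<close>)
    then show "B \<in> block n d \<phi> ` (\<Pi>\<^sub>E j\<in>{1..d}. {1..a j})"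
      using t by (intro image_eqI[of _ _ "restrict t {1..d}"]) auto
  next
    fix B assume "B \<in> block n d \<phi> ` (\<Pi>\<^sub>E j\<in>{1..d}. {1..a j})"
    then obtain t where t: "t \<in> (\<Pi>\<^sub>E j\<in>{1..d}. {1..a j})" "B = block n d \<phi> t" by blast
    then have "B = (\<Pi>\<^sub>E j\<in>{1..d}. {c \<in> {1..n}. snd (\<phi> j c) = t j})"
      using block_PiE[of t d n \<phi>] by (simp add: PiE_iff)
    moreover have "{c \<in> {1..n}. snd (\<phi> j c) = t j} \<in> P j" if "j \<in> {1..d}" for j
      using G[OF that] t(1) that by blast
    ultimately show "B \<in> cartesian_blocks d P"
      unfolding cartesian_blocks_def by blast
  qed
qed

lemma card_block:
  assumes "\<And>j. j \<in> {1..d} \<Longrightarrow> identification n (a j) (b j) (P j) (\<phi> j)"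
    and "\<tau> \<in> (\<Pi>\<^sub>E j\<in>{1..d}. {1..a j})"
  shows "card (block n d \<phi> \<tau>) = (\<Prod>j\<in>{1..d}. b j)"
proof -
  have ext: "\<tau> \<in> extensional {1..d}" using assms(2) by (simp add: PiE_def)
  have "card (block n d \<phi> \<tau>) = (\<Prod>j\<in>{1..d}. card {c \<in> {1..n}. snd (\<phi> j c) = \<tau> j})"
    unfolding block_PiE[OF ext] by (rule card_PiE) simp
  also have "\<dots> = (\<Prod>j\<in>{1..d}. b j)"
    using assms(2) by (intro prod.cong refl card_group[OF assms(1)]) auto
  finally show ?thesis .
qed

section \<open>Low idempotents applied to the graph of a hypercube\<close>

lemma Points_sudoku_scheme:
  "Points (sudoku_scheme d a b N) = (\<Pi>\<^sub>E j\<in>{1..d}. {1..b j} \<times> {1..a j}) \<times> {1..N}"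
  by (simp add: sudoku_scheme_def direct_product_def direct_power_def wreath_def one_class_def
      Let_def)

text \<open>
  The entries of the idempotent depend on the column \<open>(\<phi> \<circ> y, H y)\<close> only through the block of
  the cell \<open>y\<close> and its symbol, so the sum over the cells can be grouped by blocks.
\<close>

lemma mat_vec_low_idempotent:
  assumes id: "\<And>j. j \<in> {1..d} \<Longrightarrow> identification n (a j) (b j) (P j) (\<phi> j)"
    and H: "H \<in> cells n d \<rightarrow> {1..N}"
    and f: "f \<in> (\<Pi>\<^sub>E j\<in>{1..d}. low_indices (a j))"
    and s: "s \<in> {1..N}"
  shows "mat_vec (Points (sudoku_scheme d a b N)) (Idem (sudoku_scheme d a b N) (f, 1))
      (\<lambda>y. of_bool (y \<in> hypercube_graph n d \<phi> H)) (x, s)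
    = (\<Sum>\<tau>\<in>(\<Pi>\<^sub>E j\<in>{1..d}. {1..a j}).
        (\<Prod>j\<in>{1..d}. E_mat (a j) (f j) (snd (x j)) (\<tau> j) / real (b j))
          * deviation N H (block n d \<phi> \<tau>) s)"
proof -
  let ?X = "sudoku_scheme d a b N" and ?C = "hypercube_graph n d \<phi> H"
  let ?q = "\<lambda>y. (\<lambda>j\<in>{1..d}. \<phi> j (y j), H y)"
  let ?T = "\<Pi>\<^sub>E j\<in>{1..d}. {1..a j}"
  let ?w = "\<lambda>\<tau>. \<Prod>j\<in>{1..d}. E_mat (a j) (f j) (snd (x j)) (\<tau> j) / real (b j)"
  let ?h = "\<lambda>y. of_bool (s = H y) - 1 / real N"
  have bij: "bij_betw (\<phi> j) {1..n} ({1..b j} \<times> {1..a j})" if "j \<in> {1..d}" for j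
    using id[OF that] by (simp add: identification_def)
  have \<phi>: "\<phi> j (y j) \<in> {1..b j} \<times> {1..a j}" if "j \<in> {1..d}" "y \<in> cells n d" for j y
    using bij_betwE[OF bij[OF that(1)]] PiE_mem[OF that(2)[unfolded cells_def] that(1)] by blast
  have lab: "block_label d \<phi> y \<in> ?T" if "y \<in> cells n d" for y
    using \<phi> that by (auto simp: block_label_def mem_Times_iff)
  have inj: "inj_on ?q (cells n d)"
  proof (rule inj_onI)
    fix y z assume yz: "y \<in> cells n d" "z \<in> cells n d" "?q y = ?q z"
    show "y = z"
    proof (rule PiE_ext[OF yz(1,2)[unfolded cells_def]])
      fix j assume j: "j \<in> {1..d}"
      then have "\<phi> j (y j) = \<phi> j (z j)"
        using yz(3) by (auto simp: fun_eq_iff restrict_def split: if_splits)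
      then show "y j = z j"
        using bij_betw_imp_inj_on[OF bij[OF j]] yz(1,2) j by (auto simp: cells_def inj_on_def PiE_iff)
    qed
  qed
  have sub: "?C \<subseteq> Points ?X"
    using \<phi> H by (auto simp: hypercube_graph_def Points_sudoku_scheme)
  have fin: "finite (Points ?X)"
    by (simp add: Points_sudoku_scheme finite_PiE)
  have entry: "Idem ?X (f, 1) (x, s) (?q y) = ?w (block_label d \<phi> y) * ?h y"
    if y: "y \<in> cells n d" for y
  proof -
    have "H y \<in> {1..N}" using H y by blast
    then have "Idem ?X (f, 1) (x, s) (?q y) =
      (\<Prod>j\<in>{1..d}. Idem (wreath (one_class (b j)) (one_class (a j))) (f j) (x j) (\<phi> j (y j))) * ?h y"
      using s by (simp only: Idem_sudoku_scheme E_mat_1) simp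
    also have "(\<Prod>j\<in>{1..d}. Idem (wreath (one_class (b j)) (one_class (a j))) (f j) (x j) (\<phi> j (y j)))
      = ?w (block_label d \<phi> y)"
      by (rule prod.cong) (use f in \<open>auto simp: Idem_wreath_low block_label_def PiE_iff\<close>)
    finally show ?thesis .
  qed
  have "mat_vec (Points ?X) (Idem ?X (f, 1)) (\<lambda>y. of_bool (y \<in> ?C)) (x, s)
      = (\<Sum>z\<in>?C. Idem ?X (f, 1) (x, s) z)"
    unfolding mat_vec_def using sub fin
    by (intro sum.mono_neutral_cong_right) auto
  also have "\<dots> = (\<Sum>y\<in>cells n d. ?w (block_label d \<phi> y) * ?h y)"
    unfolding hypercube_graph_def by (simp add: sum.reindex[OF inj] entry del: One_nat_def)
  also have "\<dots> = (\<Sum>\<tau>\<in>?T. \<Sum>y\<in>block n d \<phi> \<tau>. ?w (block_label d \<phi> y) * ?h y)"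
    unfolding block_def
    by (rule sum.group[symmetric]) (use lab in \<open>auto simp: finite_cells finite_PiE\<close>)
  also have "\<dots> = (\<Sum>\<tau>\<in>?T. ?w \<tau> * deviation N H (block n d \<phi> \<tau>) s)"
    by (intro sum.cong) (auto simp: deviation_def sum_distrib_left block_def)
  finally show ?thesis .
qed

text \<open>
  The expansion shows that vanishing deviations give a design.  The converse is an inversion:
  since the low idempotents of each factor add up to the identity on its groups (divided by
  \<open>b\<^sub>j\<close>), the sum of the conditions over all low labels, taken at a point over the block \<open>\<tau>\<close>,
  isolates the deviation of that block.
\<close>

lemma delsarte_design_iff_deviation:
  assumes id: "\<And>j. j \<in> {1..d} \<Longrightarrow> identification n (a j) (b j) (P j) (\<phi> j)"
    and H: "H \<in> cells n d \<rightarrow> {1..N}"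
    and b: "\<And>j. j \<in> {1..d} \<Longrightarrow> b j \<ge> 1"
  shows "delsarte_design (sudoku_scheme d a b N) (sudoku_indices d a) (hypercube_graph n d \<phi> H)
    \<longleftrightarrow> (\<forall>\<tau>\<in>(\<Pi>\<^sub>E j\<in>{1..d}. {1..a j}). \<forall>s\<in>{1..N}. deviation N H (block n d \<phi> \<tau>) s = 0)"
    (is "?design \<longleftrightarrow> ?vanish")
proof
  let ?T = "\<Pi>\<^sub>E j\<in>{1..d}. {1..a j}" and ?F = "\<Pi>\<^sub>E j\<in>{1..d}. low_indices (a j)"
  let ?w = "\<lambda>f x \<tau>. \<Prod>j\<in>{1..d}. E_mat (a j) (f j) (snd (x j)) (\<tau> j) / real (b j)"
  have expand: "mat_vec (Points (sudoku_scheme d a b N)) (Idem (sudoku_scheme d a b N) (f, 1))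
      (\<lambda>y. of_bool (y \<in> hypercube_graph n d \<phi> H)) (x, s)
    = (\<Sum>\<tau>\<in>?T. ?w f x \<tau> * deviation N H (block n d \<phi> \<tau>) s)" if "f \<in> ?F" "s \<in> {1..N}" for f x s
    by (rule mat_vec_low_idempotent[where P = P]) (fact id H that)+
  show ?design if ?vanish
    unfolding delsarte_design_def
  proof (intro ballI)
    fix k p assume k: "k \<in> sudoku_indices d a" and p: "p \<in> Points (sudoku_scheme d a b N)"
    obtain f where f: "k = (f, 1)" "f \<in> ?F" using k by (auto simp: sudoku_indices_def)
    obtain x s where s: "p = (x, s)" "s \<in> {1..N}" using p by (auto simp: Points_sudoku_scheme)
    show "mat_vec (Points (sudoku_scheme d a b N)) (Idem (sudoku_scheme d a b N) k)
        (\<lambda>y. of_bool (y \<in> hypercube_graph n d \<phi> H)) p = 0"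
      unfolding f(1) s(1) expand[OF f(2) s(2)]
      by (rule sum.neutral) (use that s(2) in auto)
  qed
  assume D: ?design
  show ?vanish
  proof (intro ballI)
    fix \<tau> s assume \<tau>: "\<tau> \<in> ?T" and s: "s \<in> {1..N}"
    \<comment> \<open>Any point over \<open>\<tau>\<close> would do; the coordinate \<open>1\<close> inside each group exists as \<open>b\<^sub>j \<ge> 1\<close>.\<close>
    define x where "x = (\<lambda>j\<in>{1..d}. (1::nat, \<tau> j))"
    have x: "(x, s) \<in> Points (sudoku_scheme d a b N)"
      using \<tau> s b by (auto simp: x_def Points_sudoku_scheme PiE_iff)
    have sum_w: "(\<Sum>f\<in>?F. ?w f x \<sigma>) = of_bool (\<sigma> = \<tau>) * (\<Prod>j\<in>{1..d}. 1 / real (b j))"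
      if \<sigma>: "\<sigma> \<in> ?T" for \<sigma>
    proof -
      have "(\<Sum>f\<in>?F. ?w f x \<sigma>)
          = (\<Prod>j\<in>{1..d}. \<Sum>i\<in>low_indices (a j). E_mat (a j) i (snd (x j)) (\<sigma> j) / real (b j))"
        by (rule prod_sum_PiE[symmetric]) (auto simp: low_indices_def)
      also have "\<dots> = (\<Prod>j\<in>{1..d}. of_bool (\<tau> j = \<sigma> j) / real (b j))"
      proof (rule prod.cong[OF refl])
        fix j assume j: "j \<in> {1..d}"
        then have "\<tau> j \<in> {1..a j}" "\<sigma> j \<in> {1..a j}" "snd (x j) = \<tau> j"
          using \<tau> \<sigma> by (auto simp: x_def)
        then show "(\<Sum>i\<in>low_indices (a j). E_mat (a j) i (snd (x j)) (\<sigma> j) / real (b j))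
            = of_bool (\<tau> j = \<sigma> j) / real (b j)"
          using sum_E_mat_low_indices[of "\<tau> j" "a j" "\<sigma> j"] by (simp flip: sum_divide_distrib)
      qed
      also have "\<dots> = of_bool (\<sigma> = \<tau>) * (\<Prod>j\<in>{1..d}. 1 / real (b j))"
      proof (cases "\<sigma> = \<tau>")
        case False
        then obtain j where "j \<in> {1..d}" "\<tau> j \<noteq> \<sigma> j" using PiE_ext[OF \<sigma> \<tau>] by metis
        then show ?thesis using False by (auto intro!: prod_zero)
      qed simp
      finally show ?thesis .
    qed
    have "0 = (\<Sum>f\<in>?F. \<Sum>\<sigma>\<in>?T. ?w f x \<sigma> * deviation N H (block n d \<phi> \<sigma>) s)"
    proof (rule sym, rule sum.neutral, rule ballI)
      fix f assume f: "f \<in> ?F"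
      then have "(f, 1) \<in> sudoku_indices d a" by (simp add: sudoku_indices_def)
      then have "mat_vec (Points (sudoku_scheme d a b N)) (Idem (sudoku_scheme d a b N) (f, 1))
          (\<lambda>y. of_bool (y \<in> hypercube_graph n d \<phi> H)) (x, s) = 0"
        using D x unfolding delsarte_design_def by blast
      then show "(\<Sum>\<sigma>\<in>?T. ?w f x \<sigma> * deviation N H (block n d \<phi> \<sigma>) s) = 0"
        unfolding expand[OF f s] .
    qed
    also have "\<dots> = (\<Sum>\<sigma>\<in>?T. (\<Sum>f\<in>?F. ?w f x \<sigma>) * deviation N H (block n d \<phi> \<sigma>) s)"
      by (subst sum.swap) (simp add: sum_distrib_right)
    also have "\<dots> = (\<Sum>\<sigma>\<in>?T. if \<sigma> = \<tau>
        then (\<Prod>j\<in>{1..d}. 1 / real (b j)) * deviation N H (block n d \<phi> \<tau>) s else 0)"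
      by (rule sum.cong[OF refl]) (simp add: sum_w del: One_nat_def)
    also have "\<dots> = (\<Prod>j\<in>{1..d}. 1 / real (b j)) * deviation N H (block n d \<phi> \<tau>) s"
      using \<tau> by (simp add: finite_PiE)
    finally have "(\<Prod>j\<in>{1..d}. 1 / real (b j)) * deviation N H (block n d \<phi> \<tau>) s = 0" by simp
    moreover have "(\<Prod>j\<in>{1..d}. 1 / real (b j)) \<noteq> 0" using b by fastforce
    ultimately show "deviation N H (block n d \<phi> \<tau>) s = 0" by (metis mult_eq_0_iff)
  qed
qed

theorem theorem2p3:
  fixes d n N :: nat
    and a b :: "nat \<Rightarrow> nat"
    and P :: "nat \<Rightarrow> nat set set"
    and \<phi> :: "nat \<Rightarrow> nat \<Rightarrow> nat \<times> nat"
    and H :: "(nat \<Rightarrow> nat) \<Rightarrow> nat"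
  assumes "d \<ge> 2"
    and "\<And>j. j \<in> {1..d} \<Longrightarrow> a j \<ge> 1"
    and "n = (\<Prod>j\<in>{1..d}. a j)"
    and "\<And>j. j \<in> {1..d} \<Longrightarrow> b j = n div a j"
    and "N = n ^ (d - 1)"
    and "\<And>j. j \<in> {1..d} \<Longrightarrow> group_partition n (a j) (b j) (P j)"
    and "\<And>j. j \<in> {1..d} \<Longrightarrow> identification n (a j) (b j) (P j) (\<phi> j)"
    and "latin_hypercube n d {1..N} H"
  shows "sudoku_hypercube n d P {1..N} H \<longleftrightarrow>
    delsarte_design (sudoku_scheme d a b N) (sudoku_indices d a) (hypercube_graph n d \<phi> H)"
proof -
  have a: "a j \<ge> 1" if "j \<in> {1..d}" for j using assms(2)[OF that] .
  have n: "n \<ge> 1" unfolding assms(3) using a by (intro prod_ge_1) auto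
  have ab: "a j * b j = n" if "j \<in> {1..d}" for j
  proof -
    have "a j dvd n" unfolding assms(3) using that by (intro dvd_prodI) auto
    then show ?thesis by (simp add: assms(4)[OF that])
  qed
  have b: "b j \<ge> 1" if "j \<in> {1..d}" for j
    using ab[OF that] n by (cases "b j") auto
  \<comment> \<open>Multiplying \<open>a\<^sub>j b\<^sub>j = n\<close> over all \<open>j\<close> gives \<open>n (b\<^sub>1 \<cdots> b\<^sub>d) = n\<^sup>d\<close>.\<close>
  have "n * (\<Prod>j\<in>{1..d}. b j) = (\<Prod>j\<in>{1..d}. a j * b j)"
    by (simp add: assms(3) prod.distrib)
  also have "\<dots> = n ^ d" by (simp add: ab)
  also have "\<dots> = n * N" using assms(1,5) by (cases d) auto
  finally have prod_b: "(\<Prod>j\<in>{1..d}. b j) = N" using n by simp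
  have N: "N \<ge> 1" using n assms(5) by simp
  have H: "H \<in> cells n d \<rightarrow> {1..N}" using assms(8) unfolding latin_hypercube_def by blast
  have "sudoku_hypercube n d P {1..N} H
      \<longleftrightarrow> (\<forall>\<tau>\<in>(\<Pi>\<^sub>E j\<in>{1..d}. {1..a j}). each_symbol_once {1..N} H (block n d \<phi> \<tau>))"
    using assms(8) cartesian_blocks_eq[OF assms(6,7)] by (simp add: sudoku_hypercube_def)
  also have "\<dots> \<longleftrightarrow> (\<forall>\<tau>\<in>(\<Pi>\<^sub>E j\<in>{1..d}. {1..a j}). \<forall>s\<in>{1..N}. deviation N H (block n d \<phi> \<tau>) s = 0)"
    by (intro ball_cong refl each_symbol_once_iff_deviation)
      (simp_all only: finite_block N prod_b card_block[where P = P, OF assms(7)])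
  also have "\<dots> \<longleftrightarrow>
      delsarte_design (sudoku_scheme d a b N) (sudoku_indices d a) (hypercube_graph n d \<phi> H)"
    using delsarte_design_iff_deviation[where P = P, OF assms(7) H b] by simp
  finally show ?thesis .
qed

end
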